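(* Let $b\geq 5$ be an odd integer and $q=b/2$. There exist $\varepsilon>0$ and $s>0$ such that the curves $\gamma_{s,\varepsilon}\coloneqq \gamma|_{[-s,\varepsilon]}$ and $\bar\gamma_{s,\varepsilon}\coloneqq \bar\gamma|_{[-s,\varepsilon]}$ are length-minimizing in the sub-Riemannian manifold $\mathcal M$, i.e. $L_{\rm SR}(\gamma_{s,\varepsilon})=d_{\rm SR}(\gamma(-s),\gamma(\varepsilon))$ and $L_{\rm SR}(\bar\gamma_{s,\varepsilon})=d_{\rm SR}(\bar\gamma(-s),\bar\gamma(\varepsilon))$.
   Context: Fix an odd integer $b\geq5$ and set $q=b/2$. Let $P(x)=x_1^2-x_2^b$ for $x=(x_1,x_2,x_3)\in\mathbb{R}^3$. On $\mathbb{R}^3$ let $X_1=\partial_{x_1}$ and $X_2=\partial_{x_2}+P(x)^2\partial_{x_3}$, and let $\mathcal M=(\mathbb{R}^3,\Delta,g)$ be the sub-Riemannian manifold with $\Delta=\mathrm{span}\{X_1,X_2\}$ and $g$ the metric on $\Delta$ making $\{X_1,X_2\}$ orthonormal. A horizontal curve is an absolutely continuous $\eta:[0,T]\to\mathbb{R}^3$ with $\dot\eta\in\Delta$ a.e.; its length is $L_{\rm SR}(\eta)=\int_0^T\sqrt{g(\dot\eta,\dot\eta)}\,dt$, and $d_{\rm SR}(p,q)$ is the infimum of lengths of horizontal curves joining $p$ and $q$. Define $\gamma,\bar\gamma:\mathbb{R}\to\mathbb{R}^3$ by $\gamma(t)=\bar\gamma(t)=(0,t,\tfrac{t^{2b+1}}{2b+1})$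 for $t<0$, and $\gamma(t)=(t^q,t,0)$, $\bar\gamma(t)=(-t^q,t,0)$ for $t\geq0$. *)

theory Defs
  imports "HOL-Analysis.Analysis"
begin

type_synonym pt = "real \<times> real \<times> real"

definition P :: "nat \<Rightarrow> pt \<Rightarrow> real" where
  "P b x = (fst x)^2 - (fst (snd x))^b"

definition X1 :: "pt \<Rightarrow> pt" where
  "X1 x = (1, 0, 0)"

definition X2 :: "nat \<Rightarrow> pt \<Rightarrow> pt" where
  "X2 b x = (0, 1, (P b x)^2)"

definition Dist :: "nat \<Rightarrow> pt \<Rightarrow> pt set" where
  "Dist b x = span {X1 x, X2 b x}"

text \<open>The metric g: g(u1 X1 + u2 X2, u1 X1 + u2 X2) = u1^2 + u2^2 (X1, X2 orthonormal).
  Since X1 = (1,0,0) and X2 = (0,1,_), the coefficients of v in Delta are its first two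
  coordinates.\<close>
definition gSR :: "pt \<Rightarrow> real" where
  "gSR v = (fst v)^2 + (fst (snd v))^2"

definition abs_cont_on :: "real \<Rightarrow> real \<Rightarrow> (real \<Rightarrow> pt) \<Rightarrow> bool" where
  "abs_cont_on a b f \<longleftrightarrow>
     (\<forall>e>0. \<exists>d>0. \<forall>(n::nat) (l::nat \<Rightarrow> real) (r::nat \<Rightarrow> real).
        (\<forall>k<n. a \<le> l k \<and> l k \<le> r k \<and> r k \<le> b) \<and>
        (\<forall>i j. i < j \<and> j < n \<longrightarrow> r i \<le> l j) \<and>
        (\<Sum>k<n. r k - l k) < d
        \<longrightarrow> (\<Sum>k<n. dist (f (r k)) (f (l k))) < e)"

definition horizontal :: "nat \<Rightarrow> real \<Rightarrow> real \<Rightarrow> (real \<Rightarrow> pt) \<Rightarrow> bool" where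
  "horizontal b a c \<eta> \<longleftrightarrow> a \<le> c \<and> abs_cont_on a c \<eta> \<and>
     (AE t in lborel. t \<in> {a..c} \<longrightarrow>
        \<eta> differentiable (at t) \<and> vector_derivative \<eta> (at t) \<in> Dist b (\<eta> t))"

definition L_SR :: "real \<Rightarrow> real \<Rightarrow> (real \<Rightarrow> pt) \<Rightarrow> real" where
  "L_SR a c \<eta> = integral {a..c} (\<lambda>t. sqrt (gSR (vector_derivative \<eta> (at t))))"

definition d_SR :: "nat \<Rightarrow> pt \<Rightarrow> pt \<Rightarrow> real" where
  "d_SR b p q = Inf {L_SR 0 T \<eta> | T \<eta>. horizontal b 0 T \<eta> \<and> \<eta> 0 = p \<and> \<eta> T = q}"

definition gam :: "nat \<Rightarrow> real \<Rightarrow> pt" where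
  "gam b t = (if t < 0 then (0, t, t^(2*b+1) / real (2*b+1))
              else (t powr (real b / 2), t, 0))"

definition gambar :: "nat \<Rightarrow> real \<Rightarrow> pt" where
  "gambar b t = (if t < 0 then (0, t, t^(2*b+1) / real (2*b+1))
              else (- (t powr (real b / 2)), t, 0))"

end

theory Submission
  imports Defs
begin

text \<open>Let \<open>r t = t powr (b/2)\<close> for \<open>t > 0\<close> and \<open>r t = 0\<close> otherwise, so that the projection of the
  curve to the plane is the graph \<open>x1 = r x2\<close>. Extending its unit tangent covector independently of \<open>x1\<close>
  gives a 1-form of norm at most 1 which calibrates the curve up to the error \<open>cov_x' x2 * (x1 - r x2) dx2\<close>.
  Hence for a strictly shorter competitor the integral of this error (the gain \<open>g\<close>) exceeds the
  integral of the pointwise defect between speed and calibration (the excess), and the excess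
  dominates the total backtracking in \<open>x2\<close>.

  Subtracting the exact form of the reference curve from \<open>P^2 dx2\<close>, the end point condition on \<open>x3\<close>
  becomes \<open>integral W dx2 = 0\<close> with \<open>W >= 0\<close>: what \<open>W\<close> costs while moving forward has to be paid back
  by backtracking. Near a maximum of \<open>W\<close> this balance confines the competitor to a piece of length
  \<open>O(g)\<close>, on which the square root of \<open>W\<close>, having small Lipschitz constant, must fall to half of its
  maximum; so \<open>W <= c g^2\<close> with small \<open>c\<close>. Young's inequality at the scale \<open>\<sigma> = g^(1/3)\<close> bounds the gain density by
  \<open>W / g^2\<close> plus an integrable kernel, and the gain comes out smaller than \<open>g\<close>, a contradiction.
  This is where \<open>b > 4\<close> is used.\<close>

section \<open>Absolutely continuous functions\<close>

text \<open>The condition of \<open>abs_cont_on\<close> for values in any metric space, so that it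
  applies to real coordinates and compositions as well as to curves.\<close>

definition ac_on :: "real \<Rightarrow> real \<Rightarrow> (real \<Rightarrow> 'a::metric_space) \<Rightarrow> bool" where
  "ac_on a b f \<longleftrightarrow>
     (\<forall>e>0. \<exists>d>0. \<forall>(n::nat) (l::nat \<Rightarrow> real) (r::nat \<Rightarrow> real).
        (\<forall>k<n. a \<le> l k \<and> l k \<le> r k \<and> r k \<le> b) \<and>
        (\<forall>i j. i < j \<and> j < n \<longrightarrow> r i \<le> l j) \<and>
        (\<Sum>k<n. r k - l k) < d
        \<longrightarrow> (\<Sum>k<n. dist (f (r k)) (f (l k))) < e)"

lemma abs_cont_on_eq: "abs_cont_on a b f = ac_on a b f"
  unfolding abs_cont_on_def ac_on_def ..

lemma ac_onD:
  assumes "ac_on a b f" "e > 0"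
  obtains d where "d > 0"
    "\<And>(n::nat) l r. \<lbrakk>\<And>k. k < n \<Longrightarrow> a \<le> l k \<and> l k \<le> r k \<and> r k \<le> b;
        \<And>i j. \<lbrakk>i < j; j < n\<rbrakk> \<Longrightarrow> r i \<le> l j; (\<Sum>k<n. r k - l k) < d\<rbrakk>
        \<Longrightarrow> (\<Sum>k<n. dist (f (r k)) (f (l k))) < e"
proof -
  obtain d where d: "d > 0" "\<forall>(n::nat) l r. (\<forall>k<n. a \<le> l k \<and> l k \<le> r k \<and> r k \<le> b) \<and>
        (\<forall>i j. i < j \<and> j < n \<longrightarrow> r i \<le> l j) \<and> (\<Sum>k<n. r k - l k) < d
        \<longrightarrow> (\<Sum>k<n. dist (f (r k)) (f (l k))) < e"
    using assms(1)[unfolded ac_on_def, rule_format, OF assms(2)] by blast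
  show thesis
    by (rule that[OF d(1)]) (use d(2) in blast)
qed

lemma ac_on_subinterval:
  assumes "ac_on a b f" "a \<le> a'" "b' \<le> b"
  shows "ac_on a' b' f"
  unfolding ac_on_def
proof (intro allI impI)
  fix e :: real assume "e > 0"
  with assms(1) obtain d where d: "d > 0"
    "\<And>(n::nat) l r. \<lbrakk>\<And>k. k < n \<Longrightarrow> a \<le> l k \<and> l k \<le> r k \<and> r k \<le> b;
        \<And>i j. \<lbrakk>i < j; j < n\<rbrakk> \<Longrightarrow> r i \<le> l j; (\<Sum>k<n. r k - l k) < d\<rbrakk>
        \<Longrightarrow> (\<Sum>k<n. dist (f (r k)) (f (l k))) < e"
    by (rule ac_onD) blast
  show "\<exists>d>0. \<forall>(n::nat) l r. (\<forall>k<n. a' \<le> l k \<and> l k \<le> r k \<and> r k \<le> b') \<and>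
        (\<forall>i j. i < j \<and> j < n \<longrightarrow> r i \<le> l j) \<and> (\<Sum>k<n. r k - l k) < d
        \<longrightarrow> (\<Sum>k<n. dist (f (r k)) (f (l k))) < e"
  proof (intro exI[of _ d] conjI allI impI, rule d(1))
    fix n :: nat and l r :: "nat \<Rightarrow> real"
    assume *: "(\<forall>k<n. a' \<le> l k \<and> l k \<le> r k \<and> r k \<le> b') \<and>
        (\<forall>i j. i < j \<and> j < n \<longrightarrow> r i \<le> l j) \<and> (\<Sum>k<n. r k - l k) < d"
    show "(\<Sum>k<n. dist (f (r k)) (f (l k))) < e"
    proof (rule d(2))
      show "a \<le> l k \<and> l k \<le> r k \<and> r k \<le> b" if "k < n" for k
        using * assms(2,3) that by (meson order_trans)
    qed (use * in auto)
  qed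
qed

text \<open>Sums, products, compositions with C^1 functions, linear images and pairs all reduce to
  this estimate; a single dominating function is passed as both \<open>f\<close> and
  \<open>g\<close>.\<close>

lemma ac_on_dominated:
  fixes h :: "real \<Rightarrow> 'c::metric_space" and f :: "real \<Rightarrow> 'a::metric_space"
    and g :: "real \<Rightarrow> 'b::metric_space"
  assumes f: "ac_on a b f" and g: "ac_on a b g"
    and h: "\<And>s t. \<lbrakk>s \<in> {a..b}; t \<in> {a..b}\<rbrakk> \<Longrightarrow> dist (h s) (h t) \<le> C * (dist (f s) (f t) + dist (g s) (g t))"
  shows "ac_on a b h"
  unfolding ac_on_def
proof (intro allI impI)
  fix e :: real assume "e > 0"
  define B where "B = \<bar>C\<bar> + 1"
  have B: "B > 0" "C \<le> B" by (auto simp: B_def)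
  from \<open>e > 0\<close> B have e': "e / (2 * B) > 0" by simp
  from f e' obtain d1 where d1: "d1 > 0"
    "\<And>(n::nat) l r. \<lbrakk>\<And>k. k < n \<Longrightarrow> a \<le> l k \<and> l k \<le> r k \<and> r k \<le> b;
        \<And>i j. \<lbrakk>i < j; j < n\<rbrakk> \<Longrightarrow> r i \<le> l j; (\<Sum>k<n. r k - l k) < d1\<rbrakk>
        \<Longrightarrow> (\<Sum>k<n. dist (f (r k)) (f (l k))) < e / (2 * B)"
    by (rule ac_onD) blast
  from g e' obtain d2 where d2: "d2 > 0"
    "\<And>(n::nat) l r. \<lbrakk>\<And>k. k < n \<Longrightarrow> a \<le> l k \<and> l k \<le> r k \<and> r k \<le> b;
        \<And>i j. \<lbrakk>i < j; j < n\<rbrakk> \<Longrightarrow> r i \<le> l j; (\<Sum>k<n. r k - l k) < d2\<rbrakk>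
        \<Longrightarrow> (\<Sum>k<n. dist (g (r k)) (g (l k))) < e / (2 * B)"
    by (rule ac_onD) blast
  show "\<exists>d>0. \<forall>(n::nat) l r. (\<forall>k<n. a \<le> l k \<and> l k \<le> r k \<and> r k \<le> b) \<and>
        (\<forall>i j. i < j \<and> j < n \<longrightarrow> r i \<le> l j) \<and> (\<Sum>k<n. r k - l k) < d
        \<longrightarrow> (\<Sum>k<n. dist (h (r k)) (h (l k))) < e"
  proof (intro exI[of _ "min d1 d2"] conjI allI impI)
    fix n :: nat and l r :: "nat \<Rightarrow> real"
    assume *: "(\<forall>k<n. a \<le> l k \<and> l k \<le> r k \<and> r k \<le> b) \<and>
        (\<forall>i j. i < j \<and> j < n \<longrightarrow> r i \<le> l j) \<and> (\<Sum>k<n. r k - l k) < min d1 d2"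
    have "(\<Sum>k<n. dist (h (r k)) (h (l k)))
        \<le> (\<Sum>k<n. B * (dist (f (r k)) (f (l k)) + dist (g (r k)) (g (l k))))"
    proof (rule sum_mono)
      fix k assume "k \<in> {..<n}"
      then have "r k \<in> {a..b}" "l k \<in> {a..b}" using * by force+
      then have "dist (h (r k)) (h (l k)) \<le> C * (dist (f (r k)) (f (l k)) + dist (g (r k)) (g (l k)))"
        by (rule h)
      also have "\<dots> \<le> B * (dist (f (r k)) (f (l k)) + dist (g (r k)) (g (l k)))"
        by (intro mult_right_mono B) auto
      finally show "dist (h (r k)) (h (l k)) \<le> \<dots>" .
    qed
    also have "\<dots> = B * ((\<Sum>k<n. dist (f (r k)) (f (l k))) + (\<Sum>k<n. dist (g (r k)) (g (l k))))"
      by (simp add: sum_distrib_left sum.distrib ring_distribs)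
    also have "\<dots> < B * (e / (2 * B) + e / (2 * B))"
      using * by (intro mult_strict_left_mono add_strict_mono d1(2) d2(2) B) auto
    also have "\<dots> = e" using B by (simp add: field_simps)
    finally show "(\<Sum>k<n. dist (h (r k)) (h (l k))) < e" .
  qed (use d1 d2 in auto)
qed

lemma ac_on_lipschitz:
  fixes h :: "real \<Rightarrow> 'c::metric_space"
  assumes "\<And>s t. \<lbrakk>s \<in> {a..b}; t \<in> {a..b}\<rbrakk> \<Longrightarrow> dist (h s) (h t) \<le> C * dist s t"
  shows "ac_on a b h"
  unfolding ac_on_def
proof (intro allI impI)
  fix e :: real assume "e > 0"
  define B where "B = \<bar>C\<bar> + 1"
  have B: "B > 0" "C \<le> B" by (auto simp: B_def)
  show "\<exists>d>0. \<forall>(n::nat) l r. (\<forall>k<n. a \<le> l k \<and> l k \<le> r k \<and> r k \<le> b) \<and>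
        (\<forall>i j. i < j \<and> j < n \<longrightarrow> r i \<le> l j) \<and> (\<Sum>k<n. r k - l k) < d
        \<longrightarrow> (\<Sum>k<n. dist (h (r k)) (h (l k))) < e"
  proof (intro exI[of _ "e / B"] conjI allI impI)
    fix n :: nat and l r :: "nat \<Rightarrow> real"
    assume *: "(\<forall>k<n. a \<le> l k \<and> l k \<le> r k \<and> r k \<le> b) \<and>
        (\<forall>i j. i < j \<and> j < n \<longrightarrow> r i \<le> l j) \<and> (\<Sum>k<n. r k - l k) < e / B"
    have "(\<Sum>k<n. dist (h (r k)) (h (l k))) \<le> (\<Sum>k<n. B * (r k - l k))"
    proof (rule sum_mono)
      fix k assume "k \<in> {..<n}"
      then have k: "r k \<in> {a..b}" "l k \<in> {a..b}" "l k \<le> r k" using * by force+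
      then have "dist (h (r k)) (h (l k)) \<le> C * dist (r k) (l k)"
        by (intro assms)
      also have "\<dots> \<le> B * dist (r k) (l k)"
        by (intro mult_right_mono B) auto
      finally show "dist (h (r k)) (h (l k)) \<le> B * (r k - l k)"
        using k by (simp add: dist_real_def)
    qed
    also have "\<dots> < e"
    proof -
      have "(\<Sum>k<n. B * (r k - l k)) = B * (\<Sum>k<n. r k - l k)" by (simp add: sum_distrib_left)
      also have "\<dots> < B * (e / B)" using * B by (intro mult_strict_left_mono) auto
      finally show ?thesis using B by simp
    qed
    finally show "(\<Sum>k<n. dist (h (r k)) (h (l k))) < e" .
  qed (use \<open>e > 0\<close> B in auto)
qed

lemma ac_on_imp_continuous_on:
  assumes "ac_on a b f"
  shows "continuous_on {a..b} f"
  unfolding continuous_on_iff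
proof (intro ballI allI impI)
  fix x e :: real assume x: "x \<in> {a..b}" and "e > 0"
  obtain d where d: "d > 0"
    "\<And>(n::nat) l r. \<lbrakk>\<And>k. k < n \<Longrightarrow> a \<le> l k \<and> l k \<le> r k \<and> r k \<le> b;
        \<And>i j. \<lbrakk>i < j; j < n\<rbrakk> \<Longrightarrow> r i \<le> l j; (\<Sum>k<n. r k - l k) < d\<rbrakk>
        \<Longrightarrow> (\<Sum>k<n. dist (f (r k)) (f (l k))) < e"
    by (rule ac_onD[OF assms \<open>e > 0\<close>]) blast
  have "dist (f y) (f x) < e" if "y \<in> {a..b}" "dist y x < d" for y
    using d(2)[of 1 "\<lambda>_. min x y" "\<lambda>_. max x y"] that x
    by (cases "x \<le> y") (auto simp: dist_real_def dist_commute)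
  with d(1) show "\<exists>d>0. \<forall>x'\<in>{a..b}. dist x' x < d \<longrightarrow> dist (f x') (f x) < e"
    by blast
qed

text \<open>Divisions of an interval are unordered finite sets, while absolute continuity speaks of
  ordered indexed intervals. Nondegenerate intervals with disjoint interiors have distinct left end
  points, so sorting by \<open>Inf\<close> gives the enumeration.\<close>

lemma ac_on_family:
  assumes "ac_on a b f" "e > 0"
  obtains d where "d > 0"
    "\<And>D. \<lbrakk>finite D; \<And>K. K \<in> D \<Longrightarrow> K \<subseteq> {a..b}; \<And>K. K \<in> D \<Longrightarrow> \<exists>u v. K = {u..v} \<and> u < v;
       \<And>K L. \<lbrakk>K \<in> D; L \<in> D; K \<noteq> L\<rbrakk> \<Longrightarrow> interior K \<inter> interior L = {};
       (\<Sum>K\<in>D. Sup K - Inf K) < d\<rbrakk> \<Longrightarrow> (\<Sum>K\<in>D. dist (f (Sup K)) (f (Inf K))) < e"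
proof -
  from assms obtain d where d: "d > 0"
    "\<And>(n::nat) l r. \<lbrakk>\<And>k. k < n \<Longrightarrow> a \<le> l k \<and> l k \<le> r k \<and> r k \<le> b;
        \<And>i j. \<lbrakk>i < j; j < n\<rbrakk> \<Longrightarrow> r i \<le> l j; (\<Sum>k<n. r k - l k) < d\<rbrakk>
        \<Longrightarrow> (\<Sum>k<n. dist (f (r k)) (f (l k))) < e"
    by (rule ac_onD) blast
  have "(\<Sum>K\<in>D. dist (f (Sup K)) (f (Inf K))) < e"
    if D: "finite D" "\<And>K. K \<in> D \<Longrightarrow> K \<subseteq> {a..b}" "\<And>K. K \<in> D \<Longrightarrow> \<exists>u v. K = {u..v} \<and> u < v"
      "\<And>K L. \<lbrakk>K \<in> D; L \<in> D; K \<noteq> L\<rbrakk> \<Longrightarrow> interior K \<inter> interior L = {}"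
      "(\<Sum>K\<in>D. Sup K - Inf K) < d" for D :: "real set set"
  proof -
    have iv: "K = {Inf K..Sup K} \<and> Inf K < Sup K \<and> a \<le> Inf K \<and> Sup K \<le> b" if K: "K \<in> D" for K
    proof -
      obtain u v where "K = {u..v}" "u < v" using D(3)[OF K] by blast
      with D(2)[OF K] show ?thesis by auto
    qed
    have sep: "Sup K \<le> Inf L" if "K \<in> D" "L \<in> D" "K \<noteq> L" "Inf K \<le> Inf L" for K L
    proof (rule ccontr)
      assume "\<not> Sup K \<le> Inf L"
      then have "Inf L < min (Sup K) (Sup L)" using iv that by auto
      then obtain z where z: "Inf L < z" "z < min (Sup K) (Sup L)" using dense by blast
      have "interior K = {Inf K<..<Sup K}" "interior L = {Inf L<..<Sup L}"
        using iv that interior_atLeastAtMost_real by metis+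
      then have "z \<in> interior K \<inter> interior L" using z that by auto
      with D(4) that show False by blast
    qed
    have inj: "inj_on Inf D"
    proof (rule inj_onI)
      fix K L assume "K \<in> D" "L \<in> D" "Inf K = Inf L"
      then show "K = L" using sep[of K L] iv[of K] by fastforce
    qed
    define ls where "ls = sorted_list_of_set (Inf ` D)"
    define n where "n = length ls"
    define KK where "KK k = the_inv_into D Inf (ls ! k)" for k
    have ls: "set ls = Inf ` D" "sorted ls" "distinct ls"
      using D(1) by (auto simp: ls_def)
    have bij1: "bij_betw ((!) ls) {..<n} (Inf ` D)"
      using ls bij_betw_nth[of ls "{..<n}" "Inf ` D"] by (auto simp: n_def)
    have bij: "bij_betw KK {..<n} D"
      using bij_betw_trans[OF bij1 bij_betw_the_inv_into[OF inj_on_imp_bij_betw[OF inj]]]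
      by (simp add: KK_def [abs_def] o_def)
    have KKD: "KK k \<in> D" if "k < n" for k
      using bij that by (auto simp: bij_betw_def)
    have InfKK: "Inf (KK k) = ls ! k" if "k < n" for k
      using f_the_inv_into_f[OF inj, of "ls ! k"] that ls nth_mem[of k ls] by (simp add: KK_def n_def)
    have "(\<Sum>k<n. dist (f (Sup (KK k))) (f (Inf (KK k)))) < e"
    proof (rule d(2))
      show "a \<le> Inf (KK k) \<and> Inf (KK k) \<le> Sup (KK k) \<and> Sup (KK k) \<le> b" if "k < n" for k
        using iv[OF KKD[OF that]] by auto
      show "Sup (KK i) \<le> Inf (KK j)" if "i < j" "j < n" for i j
      proof (rule sep)
        show "KK i \<noteq> KK j" using bij that by (auto dest!: bij_betw_imp_inj_on dest: inj_onD[where x = i and y = j])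
        show "Inf (KK i) \<le> Inf (KK j)"
          using InfKK that ls(2) n_def by (simp add: sorted_nth_mono)
      qed (use KKD that in auto)
      show "(\<Sum>k<n. Sup (KK k) - Inf (KK k)) < d"
        using sum.reindex_bij_betw[OF bij, of "\<lambda>K. Sup K - Inf K"] D(5) by simp
    qed
    then show ?thesis
      using sum.reindex_bij_betw[OF bij, of "\<lambda>K. dist (f (Sup K)) (f (Inf K))"] by simp
  qed
  with d(1) that show thesis by blast
qed

text \<open>On tags in the exceptional null set the difference quotients are uncontrolled; there absolute
  continuity bounds the increments over intervals contained in an open set of small measure.\<close>
theorem ac_on_has_integral:
  fixes f :: "real \<Rightarrow> 'a::euclidean_space"
  assumes ac: "ac_on a b f" and "a \<le> b" and N: "negligible N"
    and der: "\<And>x. x \<in> {a..b} - N \<Longrightarrow> (f has_vector_derivative f' x) (at x)"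
  shows "(f' has_integral (f b - f a)) {a..b}"
proof -
  \<comment> \<open>With value 0 on \<open>N\<close>, an interval tagged in \<open>N\<close>
    contributes only the increment of \<open>f\<close> to the error.\<close>
  define g where "g x = (if x \<in> N then 0 else f' x)" for x
  have "(g has_integral (f b - f a)) (cbox a b)"
    unfolding has_integral
  proof (intro allI impI)
    fix e :: real assume "e > 0"
    \<comment> \<open>The \<open>+ 1\<close> keeps the denominator positive when
      \<open>a = b\<close>.\<close>
    define e1 where "e1 = e / (2 * (b - a + 1))"
    have e1: "e1 > 0" using \<open>e > 0\<close> \<open>a \<le> b\<close> by (simp add: e1_def)
    have "e1 * (b - a) < e / 2"
    proof -
      have "(b - a) / (b - a + 1) < 1" using \<open>a \<le> b\<close> by simp
      then have "e / 2 * ((b - a) / (b - a + 1)) < e / 2 * 1"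
        using \<open>e > 0\<close> by (intro mult_strict_left_mono) auto
      then show ?thesis using \<open>a \<le> b\<close> by (simp add: e1_def field_simps)
    qed
    obtain \<delta> where \<delta>: "\<delta> > 0"
      "\<And>D. \<lbrakk>finite D; \<And>K. K \<in> D \<Longrightarrow> K \<subseteq> {a..b}; \<And>K. K \<in> D \<Longrightarrow> \<exists>u v. K = {u..v} \<and> u < v;
       \<And>K L. \<lbrakk>K \<in> D; L \<in> D; K \<noteq> L\<rbrakk> \<Longrightarrow> interior K \<inter> interior L = {};
       (\<Sum>K\<in>D. Sup K - Inf K) < \<delta>\<rbrakk> \<Longrightarrow> (\<Sum>K\<in>D. dist (f (Sup K)) (f (Inf K))) < e / 2"
      by (rule ac_on_family[OF ac half_gt_zero[OF \<open>e > 0\<close>]]) blast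
    \<comment> \<open>The gauge will keep every interval tagged in \<open>N\<close> inside this open
      set, so their total length is below \<open>\<delta>\<close>.\<close>
    obtain U where U: "open U" "N \<subseteq> U" "U - N \<in> lmeasurable" "emeasure lebesgue (U - N) < ennreal \<delta>"
      using sets_lebesgue_outer_open[OF negligible_imp_sets[OF N] \<delta>(1)] by blast
    have Um: "U \<in> lmeasurable" "measure lebesgue U < \<delta>"
    proof -
      have "U = (U - N) \<union> N" using U by auto
      moreover have "N \<in> lmeasurable" "measure lebesgue N = 0" 
        using N by (auto simp: negligible_imp_measurable negligible_imp_measure0)
      moreover have "measure lebesgue (U - N) < \<delta>"
        using U(3,4) \<delta>(1) by (simp add: emeasure_eq_measure2 ennreal_less_iff)
      ultimately show "U \<in> lmeasurable" "measure lebesgue U < \<delta>"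
        using U(3) measure_Un_le[of "U - N" lebesgue N]
        by (metis fmeasurable.Un, metis (no_types, opaque_lifting) add.right_neutral fmeasurableD le_less_trans)
    qed
    have "\<exists>d>0. x \<in> {a..b} - N \<longrightarrow>
         (\<forall>y. norm (y-x) < d \<longrightarrow> norm (f y - f x - (y-x) *\<^sub>R f' x) \<le> e1 * norm (y-x))" for x
      using der[of x] e1 unfolding has_vector_derivative_def has_derivative_at_alt
      by (metis zero_less_one)
    moreover have "\<exists>d>0. x \<in> N \<longrightarrow> ball x d \<subseteq> U" for x
      using U open_contains_ball by (metis subsetD zero_less_one)
    ultimately have "\<exists>d>0. (x \<in> {a..b} - N \<longrightarrow>
         (\<forall>y. norm (y-x) < d \<longrightarrow> norm (f y - f x - (y-x) *\<^sub>R f' x) \<le> e1 * norm (y-x))) \<and>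
          (x \<in> N \<longrightarrow> ball x d \<subseteq> U)" for x
      by (metis DiffD2)
    then obtain d where d: "\<And>x. d x > 0"
      "\<And>x y. \<lbrakk>x \<in> {a..b} - N; norm (y-x) < d x\<rbrakk> \<Longrightarrow> norm (f y - f x - (y-x) *\<^sub>R f' x) \<le> e1 * norm (y-x)"
      "\<And>x. x \<in> N \<Longrightarrow> ball x (d x) \<subseteq> U"
      by metis
    show "\<exists>\<gamma>. gauge \<gamma> \<and> (\<forall>p. p tagged_division_of (cbox a b) \<and> \<gamma> fine p \<longrightarrow>
        norm ((\<Sum>(x,K)\<in>p. measure lborel K *\<^sub>R g x) - (f b - f a)) < e)"
    proof (intro exI[of _ "\<lambda>x. ball x (d x)"] conjI allI impI)
      show "gauge (\<lambda>x. ball x (d x))" using d(1) gauge_ball_dependent by blast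
      fix p assume p: "p tagged_division_of cbox a b \<and> (\<lambda>x. ball x (d x)) fine p"
      then have ptag: "p tagged_division_of cbox a b" and finep: "(\<lambda>x. ball x (d x)) fine p" by auto
      note pD = tagged_division_ofD[OF ptag]
      \<comment> \<open>Ordinary tags go to \<open>p1\<close>, nondegenerate intervals tagged in
        \<open>N\<close> to \<open>p2\<close>. The remaining intervals are single points, where
        \<open>F\<close> vanishes.\<close>
      define p1 where "p1 = {(x,K) \<in> p. x \<notin> N}"
      define p2 where "p2 = {(x,K) \<in> p. x \<in> N \<and> interior K \<noteq> {}}"
      define F where "F = (\<lambda>(x::real,K). measure lborel K *\<^sub>R g x - (f (Sup K) - f (Inf K)))"
      have ba: "b - a = (\<Sum>(x,K)\<in>p. Sup K - Inf K)" "f b - f a = (\<Sum>(x,K)\<in>p. f(Sup K) - f(Inf K))"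
        using additive_tagged_division_1[where f= "\<lambda>x. x"] additive_tagged_division_1[where f= f]
            \<open>a \<le> b\<close> ptag by auto
      have intv: "\<exists>u v. K = {u..v} \<and> u \<le> x \<and> x \<le> v \<and> a \<le> u \<and> v \<le> b \<and> K \<subseteq> ball x (d x)" if xK: "(x,K) \<in> p" for x K
      proof -
        obtain u v where K: "K = cbox u v" using pD(4) xK by blast
        have "K \<subseteq> ball x (d x)" using fineD[OF finep xK] .
        with pD(2)[OF xK] pD(3)[OF xK] K show ?thesis by (auto intro!: exI[of _ u] exI[of _ v])
      qed
      have fin: "finite p" "p1 \<subseteq> p" "p2 \<subseteq> p" "finite p1" "finite p2" "p1 \<inter> p2 = {}"
        using pD(1) by (auto simp: p1_def p2_def intro: finite_subset[of _ p])
      have "(\<Sum>(x,K)\<in>p. measure lborel K *\<^sub>R g x) - (f b - f a) = sum F p"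
        by (simp add: ba F_def sum_subtractf split_def)
      also have "\<dots> = sum F (p1 \<union> p2)"
      proof (rule sum.mono_neutral_right)
        show "\<forall>i\<in>p - (p1 \<union> p2). F i = 0"
        proof
          fix i assume i: "i \<in> p - (p1 \<union> p2)"
          obtain x K where xK: "i = (x,K)" by (cases i)
          with i have iK: "(x,K) \<in> p" "x \<in> N" "interior K = {}" by (auto simp: p1_def p2_def)
          obtain u v where uv: "K = {u..v}" "u \<le> x" "x \<le> v" using intv[OF iK(1)] by blast
          with iK have "u = v" by (auto simp: interior_atLeastAtMost_real)
          then show "F i = 0" using uv by (simp add: xK F_def)
        qed
      qed (use fin in auto)
      also have "\<dots> = sum F p1 + sum F p2"
        by (rule sum.union_disjoint) (use fin in auto)
      finally have eq: "(\<Sum>(x,K)\<in>p. measure lborel K *\<^sub>R g x) - (f b - f a) = sum F p1 + sum F p2" .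
      have "norm (sum F p1) \<le> (\<Sum>n\<in>p1. e1 * (case n of (x, k) \<Rightarrow> Sup k - Inf k))"
      proof (rule sum_norm_le)
        fix i assume i: "i \<in> p1"
        obtain x K where xK: "i = (x,K)" by (cases i)
        with i have iK: "(x,K) \<in> p" "x \<notin> N" by (auto simp: p1_def)
        obtain u v where uv: "K = {u..v}" "u \<le> x" "x \<le> v" "a \<le> u" "v \<le> b" "K \<subseteq> ball x (d x)"
          using intv[OF iK(1)] by blast
        have x: "x \<in> {a..b} - N" using uv iK by auto
        have uin: "u \<in> ball x (d x)" "v \<in> ball x (d x)" using uv by (metis atLeastAtMost_iff order_trans order_refl subsetD)+
        have "norm ((v - u) *\<^sub>R f' x - (f v - f u)) = norm (f u - f x - (u - x) *\<^sub>R f' x - (f v - f x - (v - x) *\<^sub>R f' x))"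
          by (auto simp: algebra_simps)
        also have "\<dots> \<le> norm (f u - f x - (u - x) *\<^sub>R f' x) + norm (f v - f x - (v - x) *\<^sub>R f' x)"
          by (rule norm_triangle_ineq4)
        also have "\<dots> \<le> e1 * norm (u - x) + e1 * norm (v - x)"
          using uin by (intro add_mono d(2) x) (auto simp: dist_real_def)
        also have "\<dots> = e1 * (v - u)" using uv by (simp add: algebra_simps)
        finally show "norm (F i) \<le> e1 * (case i of (x, k) \<Rightarrow> Sup k - Inf k)"
          using uv iK by (simp add: xK F_def g_def)
      qed
      also have "\<dots> = e1 * (\<Sum>(x,K)\<in>p1. Sup K - Inf K)"
        by (simp add: sum_distrib_left split_def)
      also have "\<dots> \<le> e1 * (\<Sum>(x,K)\<in>p. Sup K - Inf K)"
      proof (intro mult_left_mono sum_mono2)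
        fix i assume i: "i \<in> p - p1"
        obtain x K where xK: "i = (x,K)" by (cases i)
        with i obtain u v where "K = {u..v}" "u \<le> x" "x \<le> v" using intv[of x K] by auto
        then show "0 \<le> (case i of (x, K) \<Rightarrow> Sup K - Inf K)" by (simp add: xK)
      qed (use fin e1 in auto)
      also have "\<dots> = e1 * (b - a)" by (simp add: ba)
      finally have 1: "norm (sum F p1) < e / 2" using \<open>e1 * (b - a) < e / 2\<close> by linarith
      define D where "D = snd ` p2"
      \<comment> \<open>Two tags on one interval would make its nonempty interior disjoint from
        itself.\<close>
      have injD: "inj_on snd p2"
      proof (rule inj_onI, rule ccontr)
        fix i j assume ij: "i \<in> p2" "j \<in> p2" "snd i = snd j" "i \<noteq> j"
        then have "i \<in> p" "j \<in> p" by (auto simp: p2_def)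
        with ij(4) have "interior (snd i) \<inter> interior (snd j) = {}"
          using pD(5)[of "fst i" "snd i" "fst j" "snd j"] by (simp add: prod_eq_iff)
        with ij show False by (auto simp: p2_def)
      qed
      have Dint: "K \<subseteq> {a..b} \<and> K \<subseteq> U \<and> (\<exists>u v. K = {u..v} \<and> u < v)" if K: "K \<in> D" for K
      proof -
        obtain x where x: "(x,K) \<in> p" "x \<in> N" "interior K \<noteq> {}" using K unfolding D_def p2_def by fastforce
        obtain u v where uv: "K = {u..v}" "u \<le> x" "x \<le> v" "a \<le> u" "v \<le> b" "K \<subseteq> ball x (d x)"
          using intv[OF x(1)] by blast
        have "u < v" using x(3) uv by (simp add: interior_atLeastAtMost_real)
        with uv d(3)[OF x(2)] show ?thesis by auto
      qed
      have Ddis: "interior K \<inter> interior L = {}" if KL: "K \<in> D" "L \<in> D" "K \<noteq> L" for K L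
      proof -
        obtain x y where "(x,K) \<in> p" "(y,L) \<in> p" using KL(1,2) unfolding D_def p2_def by fastforce
        then show ?thesis using pD(5)[of x K y L] KL(3) by simp
      qed
      \<comment> \<open>As a division of its union, the family has total length equal to the measure
        of a subset of \<open>U\<close>.\<close>
      have Ddiv: "D division_of (\<Union>D)"
      proof (rule division_ofI)
        show "finite D" using fin by (simp add: D_def)
        show "K \<subseteq> \<Union>D" if "K \<in> D" for K using that by blast
        show "K \<noteq> {}" if "K \<in> D" for K using Dint[OF that] by auto
        show "\<exists>a b. K = cbox a b" if "K \<in> D" for K using Dint[OF that] by auto
      qed (use Ddis in auto)
      have "(\<Sum>K\<in>D. Sup K - Inf K) = (\<Sum>K\<in>D. measure lebesgue K)"
      proof (rule sum.cong)
        fix K assume "K \<in> D"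
        then obtain u v where "K = {u..v}" "u < v" using Dint by blast
        then show "Sup K - Inf K = measure lebesgue K" by simp
      qed simp
      also have "\<dots> = measure lebesgue (\<Union>D)" by (rule content_division[OF Ddiv])
      also have "\<dots> \<le> measure lebesgue U"
      proof (rule measure_mono_fmeasurable)
        show "\<Union>D \<in> sets lebesgue" using lmeasurable_division[OF Ddiv] by auto
      qed (use Dint Um in auto)
      finally have small: "(\<Sum>K\<in>D. Sup K - Inf K) < \<delta>" using Um by linarith
      have "norm (sum F p2) \<le> (\<Sum>i\<in>p2. dist (f (Sup (snd i))) (f (Inf (snd i))))"
        by (rule sum_norm_le) (auto simp: F_def p2_def g_def dist_norm norm_minus_commute)
      also have "\<dots> = (\<Sum>K\<in>D. dist (f (Sup K)) (f (Inf K)))"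
        unfolding D_def by (simp add: sum.reindex[OF injD])
      also have "\<dots> < e / 2"
        using fin Dint Ddis small by (intro \<delta>(2)) (auto simp: D_def)
      finally have "norm (sum F p1 + sum F p2) < e"
        using 1 norm_triangle_ineq[of "sum F p1" "sum F p2"] by linarith
      then show "norm ((\<Sum>(x,K)\<in>p. measure lborel K *\<^sub>R g x) - (f b - f a)) < e"
        using eq by simp
    qed
  qed
  then have "(g has_integral (f b - f a)) {a..b}" by simp
  then show ?thesis
    by (rule has_integral_spike[OF N, rotated]) (auto simp: g_def)
qed

text \<open>On an interval shorter than the \<open>\<delta>\<close> belonging to 1, the integrals of
  \<open>f'\<close> over the pieces of a division are increments of \<open>f\<close>, so their norms
  sum to at most 1. Bounded variation gives absolute integrability there, and short intervals are
  glued.\<close>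

theorem ac_on_absolutely_integrable:
  fixes f :: "real \<Rightarrow> 'a::euclidean_space"
  assumes ac: "ac_on a b f" and N: "negligible N"
    and der: "\<And>x. x \<in> {a..b} - N \<Longrightarrow> (f has_vector_derivative f' x) (at x)"
  shows "f' absolutely_integrable_on {a..b}"
proof -
  obtain \<delta> where \<delta>: "\<delta> > 0"
    "\<And>D. \<lbrakk>finite D; \<And>K. K \<in> D \<Longrightarrow> K \<subseteq> {a..b}; \<And>K. K \<in> D \<Longrightarrow> \<exists>u v. K = {u..v} \<and> u < v;
       \<And>K L. \<lbrakk>K \<in> D; L \<in> D; K \<noteq> L\<rbrakk> \<Longrightarrow> interior K \<inter> interior L = {};
       (\<Sum>K\<in>D. Sup K - Inf K) < \<delta>\<rbrakk> \<Longrightarrow> (\<Sum>K\<in>D. dist (f (Sup K)) (f (Inf K))) < 1"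
    by (rule ac_on_family[OF ac zero_less_one]) blast
  have sub: "(f' has_integral (f v - f u)) {u..v}" if "a \<le> u" "u \<le> v" "v \<le> b" for u v
    by (rule ac_on_has_integral[OF ac_on_subinterval[OF ac] _ N]) (use that der in auto)
  have small: "f' absolutely_integrable_on {u..v}" if uv: "a \<le> u" "u \<le> v" "v \<le> b" "v - u < \<delta>" for u v
  proof -
    have "f' absolutely_integrable_on cbox u v"
    proof (rule bounded_variation_absolutely_integrable_interval)
      show "f' integrable_on cbox u v" using sub uv by (auto simp: integrable_on_def)
      fix d assume d: "d division_of cbox u v"
      note dD = division_ofD[OF d]
      define D where "D = {K \<in> d. interior K \<noteq> {}}"
      have intv: "\<exists>x y. K = {x..y} \<and> u \<le> x \<and> x \<le> y \<and> y \<le> v" if K: "K \<in> d" for K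
        using dD(2)[OF K] dD(3)[OF K] dD(4)[OF K] by fastforce
      have D: "\<exists>x y. K = {x..y} \<and> u \<le> x \<and> x < y \<and> y \<le> v" if K: "K \<in> D" for K
        using intv[of K] K by (force simp: D_def)
      have "(\<Sum>K\<in>d. norm (integral K f')) = (\<Sum>K\<in>D. norm (integral K f'))"
      proof (rule sum.mono_neutral_right)
        show "\<forall>K\<in>d - D. norm (integral K f') = 0"
        proof
          fix K assume "K \<in> d - D"
          then obtain x y where "K = {x..y}" "x \<le> y" "interior K = {}" using intv[of K] by (auto simp: D_def)
          then have "K = {x..x}" by (simp add: interior_atLeastAtMost_real)
          then show "norm (integral K f') = 0" by simp
        qed
      qed (use dD(1) in \<open>auto simp: D_def\<close>)
      also have "\<dots> = (\<Sum>K\<in>D. dist (f (Sup K)) (f (Inf K)))"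
      proof (rule sum.cong)
        fix K assume "K \<in> D"
        then obtain x y where K: "K = {x..y}" "u \<le> x" "x < y" "y \<le> v" using D by blast
        then have "integral K f' = f y - f x" using sub[of x y] uv by (auto simp: integral_unique)
        with K show "norm (integral K f') = dist (f (Sup K)) (f (Inf K))" by (simp add: dist_norm)
      qed simp
      also have "\<dots> < 1"
      proof (rule \<delta>(2))
        have "(\<Sum>K\<in>D. Sup K - Inf K) \<le> (\<Sum>K\<in>d. Sup K - Inf K)"
          using dD(1) intv by (intro sum_mono2) (force simp: D_def)+
        also have "\<dots> = (\<Sum>K\<in>d. measure lebesgue K)"
          using intv by (intro sum.cong) force+
        also have "\<dots> = v - u" using content_division[OF d] uv by simp
        finally show "(\<Sum>K\<in>D. Sup K - Inf K) < \<delta>" using uv by linarith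
        show "K \<subseteq> {a..b}" if "K \<in> D" for K using D[OF that] uv by auto
        show "\<exists>u v. K = {u..v} \<and> u < v" if "K \<in> D" for K using D[OF that] by blast
      qed (use dD in \<open>auto simp: D_def\<close>)
      finally show "(\<Sum>K\<in>d. norm (integral K f')) \<le> 1" by simp
    qed
    then show ?thesis by simp
  qed
  have "f' absolutely_integrable_on {a..v}" if "a \<le> v" "v \<le> b" "v - a \<le> real n * (\<delta> / 2)" for n v
    using that
  proof (induction n arbitrary: v)
    case 0
    then show ?case using small[of a v] \<delta>(1) by simp
  next
    case (Suc n)
    \<comment> \<open>Steps of half the length \<open>\<delta>\<close> leave room for the strict
      inequality in \<open>small\<close>.\<close>
    define w where "w = max a (v - \<delta> / 2)"
    have w: "a \<le> w" "w \<le> v" "v - w < \<delta>" using Suc.prems \<delta>(1) by (auto simp: w_def)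
    have "f' absolutely_integrable_on {a..w}"
      using Suc.prems w \<delta>(1) by (intro Suc.IH) (auto simp: w_def max_def algebra_simps)
    moreover have "f' absolutely_integrable_on {w..v}"
      using Suc.prems w by (intro small) auto
    ultimately show ?case using w(1,2) by (rule absolutely_integrable_on_combine)
  qed
  note steps = this
  show ?thesis
  proof (cases "a \<le> b")
    case True
    obtain n :: nat where "(b - a) / (\<delta> / 2) \<le> real n" using real_arch_simple by blast
    then have "b - a \<le> real n * (\<delta> / 2)" using \<delta>(1) by (simp add: field_simps)
    then show ?thesis using steps True by blast
  qed simp
qed

section \<open>Calculus of absolutely continuous functions\<close>

text \<open>The null set is a parameter so that several coordinates share one exceptional set and
  their derivatives can be combined; on \<open>N\<close> the values of \<open>f'\<close> are
  arbitrary.\<close>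

definition ac_deriv :: "real \<Rightarrow> real \<Rightarrow> real set \<Rightarrow> (real \<Rightarrow> real) \<Rightarrow> (real \<Rightarrow> real) \<Rightarrow> bool" where
  "ac_deriv a b N f f' \<longleftrightarrow> ac_on a b f \<and> negligible N \<and>
     (\<forall>t\<in>{a..b} - N. (f has_real_derivative f' t) (at t))"

lemma ac_deriv_continuous: "ac_deriv a b N f f' \<Longrightarrow> continuous_on {a..b} f"
  by (auto simp: ac_deriv_def ac_on_imp_continuous_on)

lemma ac_deriv_has_integral:
  assumes "ac_deriv a b N f f'" "a \<le> u" "u \<le> v" "v \<le> b"
  shows "(f' has_integral (f v - f u)) {u..v}"
  by (rule ac_on_has_integral[where N = N])
    (use assms in \<open>auto simp: ac_deriv_def has_real_derivative_iff_has_vector_derivative intro: ac_on_subinterval\<close>)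

lemma ac_deriv_absolutely_integrable:
  assumes "ac_deriv a b N f f'"
  shows "f' absolutely_integrable_on {a..b}"
  by (rule ac_on_absolutely_integrable[where N = N])
    (use assms in \<open>auto simp: ac_deriv_def has_real_derivative_iff_has_vector_derivative\<close>)

lemma ac_deriv_diff:
  assumes "ac_deriv a b N f f'" "ac_deriv a b N g g'"
  shows "ac_deriv a b N (\<lambda>t. f t - g t) (\<lambda>t. f' t - g' t)"
  unfolding ac_deriv_def
proof (intro conjI ballI)
  show "ac_on a b (\<lambda>t. f t - g t)"
    by (rule ac_on_dominated[where f = f and g = g and C = 1])
      (use assms in \<open>auto simp: ac_deriv_def dist_real_def\<close>)
qed (use assms in \<open>auto simp: ac_deriv_def intro!: derivative_intros\<close>)

lemma ac_deriv_add:
  assumes "ac_deriv a b N f f'" "ac_deriv a b N g g'"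
  shows "ac_deriv a b N (\<lambda>t. f t + g t) (\<lambda>t. f' t + g' t)"
  unfolding ac_deriv_def
proof (intro conjI ballI)
  show "ac_on a b (\<lambda>t. f t + g t)"
    by (rule ac_on_dominated[where f = f and g = g and C = 1])
      (use assms in \<open>auto simp: ac_deriv_def dist_real_def\<close>)
qed (use assms in \<open>auto simp: ac_deriv_def intro!: derivative_intros\<close>)

lemma ac_deriv_mult:
  assumes f: "ac_deriv a b N f f'" and g: "ac_deriv a b N g g'"
  shows "ac_deriv a b N (\<lambda>t. f t * g t) (\<lambda>t. f' t * g t + f t * g' t)"
  unfolding ac_deriv_def
proof (intro conjI ballI)
  obtain B where B: "\<And>t. t \<in> {a..b} \<Longrightarrow> \<bar>f t\<bar> \<le> B"
    using compact_imp_bounded[OF compact_continuous_image[OF ac_deriv_continuous[OF f]]]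
    unfolding bounded_iff by fastforce
  obtain C where C: "\<And>t. t \<in> {a..b} \<Longrightarrow> \<bar>g t\<bar> \<le> C"
    using compact_imp_bounded[OF compact_continuous_image[OF ac_deriv_continuous[OF g]]]
    unfolding bounded_iff by fastforce
  show "ac_on a b (\<lambda>t. f t * g t)"
  proof (rule ac_on_dominated[where f = f and g = g and C = "\<bar>B\<bar> + \<bar>C\<bar>"])
    fix s t assume st: "s \<in> {a..b}" "t \<in> {a..b}"
    have "dist (f s * g s) (f t * g t) = \<bar>f s * (g s - g t) + g t * (f s - f t)\<bar>"
      by (simp add: dist_real_def algebra_simps)
    also have "\<dots> \<le> \<bar>f s\<bar> * \<bar>g s - g t\<bar> + \<bar>g t\<bar> * \<bar>f s - f t\<bar>"
      by (metis abs_mult abs_triangle_ineq)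
    also have "\<dots> \<le> (\<bar>B\<bar> + \<bar>C\<bar>) * \<bar>g s - g t\<bar> + (\<bar>B\<bar> + \<bar>C\<bar>) * \<bar>f s - f t\<bar>"
      using B[OF st(1)] C[OF st(2)] by (intro add_mono mult_right_mono) auto
    finally show "dist (f s * g s) (f t * g t) \<le> (\<bar>B\<bar> + \<bar>C\<bar>) * (dist (f s) (f t) + dist (g s) (g t))"
      by (simp add: dist_real_def algebra_simps)
  qed (use f g in \<open>auto simp: ac_deriv_def\<close>)
qed (use f g in \<open>auto simp: ac_deriv_def intro!: derivative_eq_intros\<close>)

text \<open>The values of \<open>f\<close> lie in a compact interval on which the continuous
  \<open>h'\<close> is bounded, so \<open>h\<close> is Lipschitz there.\<close>

lemma ac_deriv_comp:
  assumes f: "ac_deriv a b N f f'"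
    and h: "\<And>x. x \<in> {l..u} \<Longrightarrow> (h has_real_derivative h' x) (at x)"
    and h': "continuous_on {l..u} h'"
    and lu: "\<And>t. t \<in> {a..b} \<Longrightarrow> f t \<in> {l..u}"
  shows "ac_deriv a b N (\<lambda>t. h (f t)) (\<lambda>t. h' (f t) * f' t)"
  unfolding ac_deriv_def
proof (intro conjI ballI)
  obtain B where B: "\<And>x. x \<in> {l..u} \<Longrightarrow> norm (h' x) \<le> B"
    using compact_imp_bounded[OF compact_continuous_image[OF h']]
    unfolding bounded_iff by fastforce
  show "ac_on a b (\<lambda>t. h (f t))"
  proof (rule ac_on_dominated[where f = f and g = f and C = "\<bar>B\<bar>"])
    fix s t assume st: "s \<in> {a..b}" "t \<in> {a..b}"
    have "norm (h (f s) - h (f t)) \<le> B * norm (f s - f t)"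
      by (rule field_differentiable_bound[where S = "{l..u}" and f' = h'])
        (use h B lu st in \<open>auto intro: has_field_derivative_at_within\<close>)
    also have "\<dots> \<le> \<bar>B\<bar> * (norm (f s - f t) + norm (f s - f t))"
      by (intro mult_mono) auto
    finally show "dist (h (f s)) (h (f t)) \<le> \<bar>B\<bar> * (dist (f s) (f t) + dist (f s) (f t))"
      by (simp add: dist_real_def)
  qed (use f in \<open>auto simp: ac_deriv_def\<close>)
  fix t assume t: "t \<in> {a..b} - N"
  show "((\<lambda>t. h (f t)) has_real_derivative h' (f t) * f' t) (at t)"
    by (rule DERIV_chain2[OF h]) (use f t lu in \<open>auto simp: ac_deriv_def\<close>)
qed (use f in \<open>auto simp: ac_deriv_def\<close>)

lemma absolutely_integrable_continuous_mult:
  fixes g h :: "real \<Rightarrow> real"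
  assumes "continuous_on {a..b} h" "g absolutely_integrable_on {a..b}"
  shows "(\<lambda>t. h t * g t) absolutely_integrable_on {a..b}"
proof (rule absolutely_integrable_bounded_measurable_product_real)
  show "h \<in> borel_measurable (lebesgue_on {a..b})"
    using assms(1) by (intro continuous_imp_measurable_on_sets_lebesgue) auto
  show "bounded (h ` {a..b})"
    using assms(1) by (intro compact_imp_bounded compact_continuous_image) auto
qed (use assms in auto)

text \<open>Take \<open>c\<close> as the maximum of the compact sublevel set. The intermediate value
  theorem shows that the level is attained at \<open>c\<close>, and maximality keeps
  \<open>w\<close> above it afterwards.\<close>

lemma last_level_time:
  fixes w :: "real \<Rightarrow> real"
  assumes "a \<le> b" "continuous_on {a..b} w" "w a \<le> h" "h \<le> w b"
  obtains c where "c \<in> {a..b}" "w c = h" "\<And>t. t \<in> {c..b} \<Longrightarrow> h \<le> w t"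
proof -
  define S where "S = {a..b} \<inter> w -` {..h}"
  have "closed S" unfolding S_def
    using assms(2) by (rule continuous_closed_preimage) auto
  moreover have "bounded S" by (rule bounded_subset[of "{a..b}"]) (auto simp: S_def)
  moreover have "a \<in> S" using assms by (auto simp: S_def)
  ultimately obtain c where c: "c \<in> S" "\<And>t. t \<in> S \<Longrightarrow> t \<le> c"
    using compact_attains_sup[of S] compact_eq_bounded_closed by blast
  have cab: "c \<in> {a..b}" "w c \<le> h" using c by (auto simp: S_def)
  have "continuous_on {c..b} w" using assms(2) by (rule continuous_on_subset) (use cab in auto)
  then obtain z where z: "c \<le> z" "z \<le> b" "w z = h"
    using IVT'[of w c h b] cab assms(4) by auto
  then have "z \<in> S" using cab by (auto simp: S_def)
  with c z have "z = c" by (simp add: antisym)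
  show thesis
  proof (rule that[OF cab(1)])
    show "w c = h" using z \<open>z = c\<close> by simp
    show "h \<le> w t" if "t \<in> {c..b}" for t
    proof (rule ccontr)
      assume "\<not> h \<le> w t"
      then have "t \<in> S" using that cab by (auto simp: S_def)
      then have "t = c" using c(2) that by force
      with \<open>w c = h\<close> \<open>\<not> h \<le> w t\<close> show False by simp
    qed
  qed
qed

section \<open>Geometry of the cusp\<close>

text \<open>The truncation gives the coordinates of the curves and their derivatives one formula on
  the whole line, with two-sided derivatives at 0 for exponents above 1.\<close>

definition pos_powr :: "real \<Rightarrow> real \<Rightarrow> real" where
  "pos_powr p t = (if t \<le> 0 then 0 else t powr p)"

lemma pos_powr_nonneg [simp]: "0 \<le> pos_powr p t"
  by (simp add: pos_powr_def)

lemma pos_powr_nonpos [simp]: "t \<le> 0 \<Longrightarrow> pos_powr p t = 0"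
  by (simp add: pos_powr_def)

lemma pos_powr_has_derivative:
  assumes "p > 1"
  shows "(pos_powr p has_real_derivative p * pos_powr (p - 1) t) (at t)"
proof -
  consider "t > 0" | "t < 0" | "t = 0" by linarith
  then show ?thesis
  proof cases
    case 1
    have "((\<lambda>t. t powr p) has_real_derivative p * t powr (p - 1)) (at t)"
      using 1 by (rule has_real_derivative_powr)
    then have "(pos_powr p has_real_derivative p * t powr (p - 1)) (at t)"
      by (rule has_field_derivative_transform_within_open[of _ _ _ "{0<..}"]) (use 1 in \<open>auto simp: pos_powr_def\<close>)
    then show ?thesis using 1 by (simp add: pos_powr_def)
  next
    case 2
    have "((\<lambda>t::real. 0) has_real_derivative 0) (at t)" by simp
    then have "(pos_powr p has_real_derivative 0) (at t)"
      by (rule has_field_derivative_transform_within_open[of _ _ _ "{..<0}"]) (use 2 in \<open>auto simp: pos_powr_def\<close>)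
    then show ?thesis using 2 by simp
  next
    case 3
    \<comment> \<open>At 0 the difference quotient is dominated by this power, which tends to 0
      because \<open>p > 1\<close>.\<close>
    have "((\<lambda>h. \<bar>h\<bar> powr (p - 1)) \<longlongrightarrow> 0) (at (0::real))"
      using assms by (auto intro!: tendsto_eq_intros)
    then have "((\<lambda>h. (pos_powr p h - pos_powr p 0) / (h - 0)) \<longlongrightarrow> 0) (at 0)"
    proof (rule Lim_null_comparison[rotated])
      show "\<forall>\<^sub>F h in at 0. norm ((pos_powr p h - pos_powr p 0) / (h - 0)) \<le> \<bar>h\<bar> powr (p - 1)"
        unfolding eventually_at_filter
      proof (intro always_eventually allI impI)
        fix h :: real
        show "norm ((pos_powr p h - pos_powr p 0) / (h - 0)) \<le> \<bar>h\<bar> powr (p - 1)"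
          by (cases "h \<le> 0") (auto simp: pos_powr_def powr_diff divide_nonneg_nonpos)
      qed
    qed
    then show ?thesis using 3 by (simp add: has_field_derivative_iff)
  qed
qed

lemma continuous_on_pos_powr: "p > 0 \<Longrightarrow> continuous_on S (pos_powr p)"
proof -
  assume p: "p > 0"
  have "pos_powr p = (\<lambda>t. (max 0 t) powr p)" by (auto simp: pos_powr_def max_def fun_eq_iff)
  moreover have "continuous_on S (\<lambda>t. (max 0 t) powr p)"
    using p by (intro continuous_on_powr' continuous_intros) auto
  ultimately show ?thesis by simp
qed

lemma pos_powr_le_linear: "\<lbrakk>1 \<le> p; 0 \<le> t; t \<le> 1\<rbrakk> \<Longrightarrow> pos_powr p t \<le> t"
  using powr_mono'[of 1 p t] by (auto simp: pos_powr_def)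

lemma pos_powr_le_1: "\<lbrakk>0 \<le> p; t \<le> 1\<rbrakk> \<Longrightarrow> pos_powr p t \<le> 1"
  by (auto simp: pos_powr_def powr_le1)

lemma pos_powr_nat: "t \<ge> 0 \<Longrightarrow> n > 0 \<Longrightarrow> pos_powr (real n) t = t ^ n"
  by (auto simp: pos_powr_def powr_realpow)

lemma pos_powr_half_sq: "t \<ge> 0 \<Longrightarrow> n > 0 \<Longrightarrow> (pos_powr (real n / 2) t)\<^sup>2 = t ^ n"
  by (auto simp: pos_powr_def powr_realpow simp flip: powr_numeral powr_powr) (simp add: powr_powr powr_realpow)

section \<open>The reference graph, its covector and the weight \<open>W\<close>\<close>

locale cusp =
  fixes b :: nat
  assumes odd_b: "odd b" and b_ge_5: "5 \<le> b"
begin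

definition q :: real where "q = real b / 2"
definition r :: "real \<Rightarrow> real" where "r = pos_powr q"
definition r' :: "real \<Rightarrow> real" where "r' t = q * pos_powr (q - 1) t"
definition r'' :: "real \<Rightarrow> real" where "r'' t = q * (q - 1) * pos_powr (q - 2) t"
definition cusp_speed :: "real \<Rightarrow> real" where "cusp_speed t = sqrt (1 + (r' t)\<^sup>2)"
text \<open>The unit covector along the curve is \<open>cov_x dx1 + (1 / cusp_speed) dx2\<close>.\<close>
definition cov_x :: "real \<Rightarrow> real" where "cov_x t = r' t / cusp_speed t"
definition cov_x' :: "real \<Rightarrow> real" where "cov_x' t = r'' t / (cusp_speed t) ^ 3"
text \<open>The third coordinate of both curves as a function of x2; its derivative is
  \<open>P^2\<close> along them.\<close>

definition hgt :: "real \<Rightarrow> real" where "hgt t = - pos_powr (real (2 * b + 1)) (- t) / real (2 * b + 1)"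
text \<open>\<open>P^2\<close> at (x, t) minus \<open>P^2\<close> on the reference curve at the same
  x2, rearranged into nonnegative terms. The zero set is the union of the planar projections of the
  two curves.\<close>

definition W :: "real \<Rightarrow> real \<Rightarrow> real" where "W x t = (x\<^sup>2 - (r t)\<^sup>2)\<^sup>2 + 2 * x\<^sup>2 * (r (- t))\<^sup>2"
text \<open>A stand-in for the square root of \<open>W\<close>, comparable to it up to a factor and
  Lipschitz with a small constant near the origin.\<close>

definition W_root :: "real \<Rightarrow> real \<Rightarrow> real" where "W_root x t = \<bar>x\<^sup>2 - (r t)\<^sup>2\<bar> + \<bar>x\<bar> * r (- t)"
text \<open>Any sufficiently small radius works; the sixth power makes \<open>q^2 * sqrt (rho powr (1/3)) = 1/32\<close>.\<close>
definition rho :: real where "rho = (1 / (32 * q\<^sup>2)) ^ 6"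

lemma q_ge: "q \<ge> 5 / 2"
  using b_ge_5 by (simp add: q_def)

lemma r_nonneg [simp]: "0 \<le> r t" and r'_nonneg [simp]: "0 \<le> r' t" and r''_nonneg [simp]: "0 \<le> r'' t"
  using q_ge by (auto simp: r_def r'_def r''_def)

lemma r_nonpos [simp]: "t \<le> 0 \<Longrightarrow> r t = 0" and r'_nonpos [simp]: "t \<le> 0 \<Longrightarrow> r' t = 0"
  by (auto simp: r_def r'_def)

lemma r_sq: "t \<ge> 0 \<Longrightarrow> (r t)\<^sup>2 = t ^ b"
  using b_ge_5 by (simp add: r_def q_def pos_powr_half_sq)

text \<open>At most one of the two terms is nonzero. For negative \<open>t\<close>, oddness of
  \<open>b\<close> gives \<open>t ^ b\<close> the sign that makes the cross term of \<open>W\<close>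
  nonnegative.\<close>

lemma power_b: "t ^ b = (r t)\<^sup>2 - (r (- t))\<^sup>2"
proof (cases "t \<ge> 0")
  case True
  then show ?thesis by (simp add: r_sq)
next
  case False
  then show ?thesis using r_sq[of "- t"] odd_b by simp
qed

lemma W_eq: "(x\<^sup>2 - t ^ b)\<^sup>2 - pos_powr (real (2 * b)) (- t) = W x t"
proof (cases "t \<ge> 0")
  case True
  then show ?thesis by (simp add: power_b W_def)
next
  case False
  then have "pos_powr (real (2 * b)) (- t) = ((r (- t))\<^sup>2)\<^sup>2"
    using b_ge_5 by (subst pos_powr_nat) (auto simp: r_sq power_mult mult.commute)
  with False show ?thesis by (simp add: power_b W_def power2_eq_square algebra_simps)
qed

lemma r_deriv: "(r has_real_derivative r' t) (at t)"
  unfolding r_def r'_def using q_ge by (intro pos_powr_has_derivative) auto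

lemma r'_deriv: "(r' has_real_derivative r'' t) (at t)"
proof -
  have "((\<lambda>t. q * pos_powr (q - 1) t) has_real_derivative q * ((q - 1) * pos_powr (q - 1 - 1) t)) (at t)"
    using q_ge by (intro DERIV_cmult pos_powr_has_derivative) auto
  then show ?thesis by (simp add: r'_def [abs_def] r''_def algebra_simps)
qed

lemma hgt_deriv: "(hgt has_real_derivative pos_powr (real (2 * b)) (- t)) (at t)"
proof -
  have "((\<lambda>t. pos_powr (real (2 * b + 1)) (- t)) has_real_derivative
      real (2 * b + 1) * pos_powr (real (2 * b + 1) - 1) (- t) * (- 1)) (at t)"
    using b_ge_5 by (intro DERIV_chain2[OF pos_powr_has_derivative]) (auto intro!: derivative_eq_intros)
  from DERIV_cmult[OF this, of "- 1 / real (2 * b + 1)"] show ?thesis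
    by (simp add: hgt_def [abs_def])
qed

lemma cusp_speed_ge_1: "cusp_speed t \<ge> 1"
  by (simp add: cusp_speed_def)

lemma cusp_speed_sq: "(cusp_speed t)\<^sup>2 = 1 + (r' t)\<^sup>2"
  by (simp add: cusp_speed_def)

lemma cov_x_deriv: "(cov_x has_real_derivative cov_x' t) (at t)"
proof -
  have p: "1 + (r' t)\<^sup>2 > 0" by (simp add: add_pos_nonneg)
  have s: "(cusp_speed has_real_derivative r' t * r'' t / cusp_speed t) (at t)"
    unfolding cusp_speed_def [abs_def]
    using p by (auto intro!: derivative_eq_intros r'_deriv simp: field_simps)
  have "(cov_x has_real_derivative (r'' t * cusp_speed t - r' t * (r' t * r'' t / cusp_speed t)) / (cusp_speed t * cusp_speed t)) (at t)"
    unfolding cov_x_def [abs_def] using cusp_speed_ge_1[of t]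
    by (intro DERIV_divide r'_deriv s) auto
  also have "(r'' t * cusp_speed t - r' t * (r' t * r'' t / cusp_speed t)) / (cusp_speed t * cusp_speed t)
      = r'' t * ((cusp_speed t)\<^sup>2 - (r' t)\<^sup>2) / (cusp_speed t) ^ 3"
    using cusp_speed_ge_1[of t] by (simp add: field_simps power2_eq_square power3_eq_cube)
  also have "\<dots> = cov_x' t" by (simp add: cusp_speed_sq cov_x'_def)
  finally show ?thesis .
qed

lemma continuous_on_r [continuous_intros]: "continuous_on S r"
  by (rule DERIV_continuous_on[where D = r']) (auto intro: r_deriv has_field_derivative_at_within)

lemma continuous_on_r': "continuous_on S r'"
  by (rule DERIV_continuous_on[where D = r'']) (auto intro: r'_deriv has_field_derivative_at_within)

lemma continuous_on_r'': "continuous_on S r''"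
  unfolding r''_def [abs_def] using q_ge by (intro continuous_intros continuous_on_pos_powr) auto

lemma continuous_on_cusp_speed: "continuous_on S cusp_speed"
  unfolding cusp_speed_def [abs_def] by (intro continuous_intros continuous_on_r')

lemma continuous_on_cov_x: "continuous_on S cov_x"
  by (rule DERIV_continuous_on[where D = cov_x']) (auto intro: cov_x_deriv has_field_derivative_at_within)

lemma continuous_on_cov_x': "continuous_on S cov_x'"
  unfolding cov_x'_def [abs_def]
proof (intro continuous_intros continuous_on_r'' continuous_on_cusp_speed ballI)
  show "cusp_speed t ^ 3 \<noteq> 0" for t using cusp_speed_ge_1[of t] by auto
qed

lemma cov_x'_nonneg: "0 \<le> cov_x' t"
  using cusp_speed_ge_1[of t] by (simp add: cov_x'_def)

lemma cov_x'_le: "cov_x' t \<le> q\<^sup>2 * pos_powr (q - 2) t"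
proof -
  have "cov_x' t \<le> r'' t / 1"
    unfolding cov_x'_def using cusp_speed_ge_1[of t] by (intro divide_left_mono one_le_power) auto
  also have "r'' t \<le> q\<^sup>2 * pos_powr (q - 2) t"
    unfolding r''_def power2_eq_square using q_ge by (intro mult_right_mono mult_left_mono) auto
  finally show ?thesis by simp
qed

section \<open>Bounds for \<open>W\<close> and smallness on the box of radius
  \<open>rho\<close>\<close>

lemma W_nonneg [simp]: "0 \<le> W x t"
  by (simp add: W_def)

lemma W_root_nonneg [simp]: "0 \<le> W_root x t"
  by (simp add: W_root_def)

lemma W_le: "W x t \<le> 2 * (W_root x t)\<^sup>2"
proof -
  have "(W_root x t)\<^sup>2 = (x\<^sup>2 - (r t)\<^sup>2)\<^sup>2 + x\<^sup>2 * (r (- t))\<^sup>2 + 2 * (\<bar>x\<^sup>2 - (r t)\<^sup>2\<bar> * (\<bar>x\<bar> * r (- t)))"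
    by (simp add: W_root_def power2_sum power_mult_distrib)
  moreover have "0 \<le> \<bar>x\<^sup>2 - (r t)\<^sup>2\<bar> * (\<bar>x\<bar> * r (- t))" by simp
  moreover have "0 \<le> (x\<^sup>2 - (r t)\<^sup>2)\<^sup>2" by simp
  ultimately show ?thesis unfolding W_def by argo
qed

lemma W_ge: "(W_root x t)\<^sup>2 \<le> 2 * W x t"
proof -
  have "(W_root x t)\<^sup>2 \<le> 2 * (\<bar>x\<^sup>2 - (r t)\<^sup>2\<bar>\<^sup>2 + (\<bar>x\<bar> * r (- t))\<^sup>2)"
    unfolding W_root_def using sum_squares_bound[of "\<bar>x\<^sup>2 - (r t)\<^sup>2\<bar>" "\<bar>x\<bar> * r (- t)"]
    by (simp add: power2_sum)
  moreover have "W x t = (x\<^sup>2 - (r t)\<^sup>2)\<^sup>2 + 2 * (\<bar>x\<bar> * r (- t))\<^sup>2"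
    by (simp add: W_def power_mult_distrib)
  moreover have "0 \<le> (\<bar>x\<bar> * r (- t))\<^sup>2" by simp
  moreover have "c \<le> 2 * V" if "c \<le> 2 * (A + B)" "V = A + 2 * B" "0 \<le> B" for c A B V :: real
    using that by argo
  ultimately show ?thesis by (metis power2_abs)
qed

text \<open>Factor \<open>x^2 - (r t)^2\<close>: above the graph, \<open>x + r t\<close> is at least
  \<open>x - r t\<close> and at least \<open>r t\<close>. The first bound serves near the origin,
  the second away from it.\<close>

lemma W_ge_above:
  assumes "r t \<le> x"
  shows "(x - r t) ^ 4 \<le> W x t" "(x - r t)\<^sup>2 * (r t)\<^sup>2 \<le> W x t"
proof -
  have "(x\<^sup>2 - (r t)\<^sup>2)\<^sup>2 = (x - r t)\<^sup>2 * (x + r t)\<^sup>2"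
    by (simp add: power2_eq_square algebra_simps)
  then have W: "W x t \<ge> (x - r t)\<^sup>2 * (x + r t)\<^sup>2"
    by (simp add: W_def)
  have "(x - r t)\<^sup>2 * (x - r t)\<^sup>2 \<le> (x - r t)\<^sup>2 * (x + r t)\<^sup>2"
    using assms by (intro mult_left_mono power_mono) auto
  with W show "(x - r t) ^ 4 \<le> W x t" by (simp add: power4_eq_xxxx power2_eq_square mult.assoc)
  have "(x - r t)\<^sup>2 * (r t)\<^sup>2 \<le> (x - r t)\<^sup>2 * (x + r t)\<^sup>2"
    using assms by (intro mult_left_mono power_mono) (auto intro: order_trans[OF r_nonneg assms])
  with W show "(x - r t)\<^sup>2 * (r t)\<^sup>2 \<le> W x t" by linarith
qed

text \<open>The third bound controls the slope \<open>r'\<close>, the fourth the gain made while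
  moving backwards, and the fifth the contribution of \<open>W\<close> to the gain; 318 is the
  constant of \<open>root_along_bound\<close>.\<close>

lemma rho_bounds:
  shows "0 < rho" "rho \<le> 1" "q * rho \<le> 1 / 2" "q\<^sup>2 * (2 * rho) \<le> 1 / 8"
    "8 * (q\<^sup>2)\<^sup>2 * (2 * (318 * rho)\<^sup>2) \<le> 1 / 8"
proof -
  \<comment> \<open>Then \<open>rho = z ^ 6\<close> and \<open>q^2 * z = 1 / 32\<close>, and
    \<open>q >= 5 / 2\<close> gives \<open>z <= 1 / 200\<close>.\<close>
  define z where "z = 1 / (32 * q\<^sup>2)"
  have q2: "q\<^sup>2 \<ge> 25 / 4" using power_mono[OF q_ge, of 2] by (simp add: power2_eq_square)
  have "q \<noteq> 0" using q_ge by simp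
  then have z: "z > 0" "z \<le> 1 / 200" "q\<^sup>2 * z = 1 / 32"
    using q2 by (auto simp: z_def divide_simps)
  have rz: "rho = z ^ 6" by (simp add: rho_def z_def)
  show "0 < rho" using z by (simp add: rz)
  have "z ^ 6 = z * z ^ 5" by (simp flip: power_Suc)
  then have rl: "rho \<le> z * (1 / 200) ^ 5"
    unfolding rz using z by (simp only:) (intro mult_left_mono power_mono, auto)
  note rl
  also have "\<dots> \<le> 1 * 1" using z by (intro mult_mono power_le_one) auto
  finally show "rho \<le> 1" by simp
  have "q\<^sup>2 * rho \<le> q\<^sup>2 * (z * (1 / 200) ^ 5)" by (intro mult_left_mono rl) auto
  also have "\<dots> = 1 / 32 * (1 / 200) ^ 5" using z(3) by simp
  finally have *: "q\<^sup>2 * rho \<le> 1 / 32 * (1 / 200) ^ 5" .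
  have "(1 / 200 :: real) ^ 5 \<le> 1" by (rule power_le_one) auto
  with * have **: "q\<^sup>2 * rho \<le> 1 / 32" by linarith
  then show "q\<^sup>2 * (2 * rho) \<le> 1 / 8" by simp
  have "q * rho \<le> q\<^sup>2 * rho"
    using q_ge \<open>0 < rho\<close> by (intro mult_right_mono) (auto simp: power2_eq_square)
  with ** show "q * rho \<le> 1 / 2" by simp
  have "8 * (q\<^sup>2)\<^sup>2 * (2 * (318 * rho)\<^sup>2) = 16 * 318\<^sup>2 * (q\<^sup>2 * rho)\<^sup>2"
    by (simp add: power_mult_distrib)
  also have "\<dots> \<le> 16 * 318\<^sup>2 * (1 / 32 * (1 / 200) ^ 5)\<^sup>2"
    using * \<open>0 < rho\<close> by (intro mult_left_mono power_mono) auto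
  also have "\<dots> = 16 * 318\<^sup>2 / 1024 / 200 ^ 10" by (simp add: power_divide power_mult_distrib)
  also have "\<dots> \<le> 1 / 8" by simp
  finally show "8 * (q\<^sup>2)\<^sup>2 * (2 * (318 * rho)\<^sup>2) \<le> 1 / 8" .
qed

lemma r'_le: "t \<le> rho \<Longrightarrow> r' t \<le> 1 / 2"
proof (cases "t \<le> 0")
  case False
  assume "t \<le> rho"
  have "r' t \<le> q * t"
    unfolding r'_def using False q_ge rho_bounds \<open>t \<le> rho\<close> by (intro mult_left_mono pos_powr_le_linear) auto
  also have "\<dots> \<le> q * rho" using \<open>t \<le> rho\<close> q_ge by (intro mult_left_mono) auto
  finally show ?thesis using rho_bounds by linarith
qed simp

lemma r_le: "t \<le> rho \<Longrightarrow> r t \<le> rho"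
proof (cases "t \<le> 0")
  case False
  assume "t \<le> rho"
  then show ?thesis using False pos_powr_le_linear[of q t] q_ge rho_bounds by (simp add: r_def)
qed (use rho_bounds in simp)

lemma r_lipschitz:
  assumes "s \<le> rho" "t \<le> rho"
  shows "\<bar>r s - r t\<bar> \<le> \<bar>s - t\<bar>"
proof -
  have "norm (r s - r t) \<le> 1 * norm (s - t)"
  proof (rule field_differentiable_bound[where S = "{..rho}" and f' = r'])
    show "norm (r' z) \<le> 1" if "z \<in> {..rho}" for z using r'_le[of z] that by simp
  qed (use assms in \<open>auto intro: r_deriv has_field_derivative_at_within\<close>)
  then show ?thesis by simp
qed

text \<open>On the box, squares have Lipschitz constant \<open>2 * rho\<close>, \<open>r\<close> has
  Lipschitz constant 1, and both factors of the product term are bounded by \<open>rho\<close>. The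
  smallness of the constant is what makes the later bound on \<open>W\<close> effective.\<close>

lemma W_root_lipschitz:
  assumes "\<bar>x\<bar> \<le> rho" "\<bar>y\<bar> \<le> rho" "\<bar>s\<bar> \<le> rho" "\<bar>t\<bar> \<le> rho"
  shows "\<bar>W_root x s - W_root y t\<bar> \<le> 3 * rho * (\<bar>x - y\<bar> + \<bar>s - t\<bar>)"
proof -
  have sq: "\<bar>u\<^sup>2 - v\<^sup>2\<bar> \<le> 2 * rho * \<bar>u - v\<bar>" if "\<bar>u\<bar> \<le> rho" "\<bar>v\<bar> \<le> rho" for u v :: real
  proof -
    have "\<bar>u\<^sup>2 - v\<^sup>2\<bar> = \<bar>u + v\<bar> * \<bar>u - v\<bar>"
      by (simp add: abs_mult [symmetric] power2_eq_square algebra_simps)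
    also have "\<dots> \<le> 2 * rho * \<bar>u - v\<bar>" using that by (intro mult_right_mono) auto
    finally show ?thesis .
  qed
  have rb: "\<bar>r s\<bar> \<le> rho" "\<bar>r t\<bar> \<le> rho" "\<bar>r (- s)\<bar> \<le> rho" "\<bar>r (- t)\<bar> \<le> rho"
    using assms r_le[of s] r_le[of t] r_le[of "- s"] r_le[of "- t"] by auto
  have 1: "\<bar>x\<^sup>2 - y\<^sup>2\<bar> \<le> 2 * rho * \<bar>x - y\<bar>" using assms by (intro sq)
  have "\<bar>(r s)\<^sup>2 - (r t)\<^sup>2\<bar> \<le> 2 * rho * \<bar>r s - r t\<bar>" using rb by (intro sq)
  also have "\<dots> \<le> 2 * rho * \<bar>s - t\<bar>"
    using assms rho_bounds(1) by (intro mult_left_mono r_lipschitz) auto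
  finally have 2: "\<bar>(r s)\<^sup>2 - (r t)\<^sup>2\<bar> \<le> 2 * rho * \<bar>s - t\<bar>" .
  have "\<bar>\<bar>x\<bar> * r (- s) - \<bar>y\<bar> * r (- t)\<bar> = \<bar>\<bar>x\<bar> * (r (- s) - r (- t)) + r (- t) * (\<bar>x\<bar> - \<bar>y\<bar>)\<bar>"
    by (simp add: algebra_simps)
  also have "\<dots> \<le> \<bar>x\<bar> * \<bar>r (- s) - r (- t)\<bar> + \<bar>r (- t)\<bar> * \<bar>\<bar>x\<bar> - \<bar>y\<bar>\<bar>"
    by (rule order_trans[OF abs_triangle_ineq]) (simp add: abs_mult)
  also have "\<dots> \<le> rho * \<bar>s - t\<bar> + rho * \<bar>x - y\<bar>"
    using assms rb r_lipschitz[of "- s" "- t"] by (intro add_mono mult_mono) (auto simp: abs_minus_commute)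
  finally have 3: "\<bar>\<bar>x\<bar> * r (- s) - \<bar>y\<bar> * r (- t)\<bar> \<le> rho * \<bar>s - t\<bar> + rho * \<bar>x - y\<bar>" .
  have "\<bar>W_root x s - W_root y t\<bar> \<le> \<bar>x\<^sup>2 - y\<^sup>2\<bar> + \<bar>(r s)\<^sup>2 - (r t)\<^sup>2\<bar> + \<bar>\<bar>x\<bar> * r (- s) - \<bar>y\<bar> * r (- t)\<bar>"
    unfolding W_root_def by linarith
  with 1 2 3 show ?thesis by (simp add: algebra_simps)
qed

section \<open>The pointwise estimate of the gain\<close>

lemma frac_le_cross: "\<lbrakk>a * d \<le> c * e; 0 < e; 0 < d\<rbrakk> \<Longrightarrow> a / e \<le> c / d" for a c d e :: real
  by (simp add: field_simps)

text \<open>The left side bounds the gain per unit of x2 above the graph. Below the scale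
  \<open>\<sigma>\<close> the quartic bound on \<open>W\<close> is used, beyond it the quadratic
  one. The second term on the right is a kernel whose integral over the line is of order
  \<open>\<sigma> ^ 3\<close>.\<close>

lemma key_pointwise:
  assumes \<sigma>: "0 < \<sigma>" "\<sigma> ^ 3 \<le> rho" and t: "t \<le> 1" and x: "r t \<le> x"
  shows "q\<^sup>2 * pos_powr (q - 2) t * (x - r t)
    \<le> 8 * (q\<^sup>2)\<^sup>2 * W x t / \<sigma> ^ 6 + \<sigma> ^ 4 / (16 * (\<sigma>\<^sup>2 + t\<^sup>2))"
proof -
  define u where "u = x - r t"
  define k where "k = q\<^sup>2"
  have u: "u \<ge> 0" using x by (simp add: u_def)
  have k: "k \<ge> 25 / 4" using power_mono[OF q_ge, of 2] by (simp add: k_def power2_eq_square)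
  consider "t \<le> 0" | "0 < t" "t < \<sigma>" | "t \<ge> \<sigma>" by linarith
  then show ?thesis
  proof cases
    case 1
    then show ?thesis using \<sigma> by simp
  next
    case 2
    define z where "z = 1 / (32 * k)"
    have z: "z > 0" using k by (simp add: z_def)
    \<comment> \<open>Since \<open>rho = z ^ 6\<close>, the hypothesis on \<open>\<sigma>\<close>
      gives \<open>sqrt t <= z\<close>.\<close>
    have "\<sigma> ^ 3 \<le> (z\<^sup>2) ^ 3" using \<sigma>(2) by (simp add: rho_def z_def k_def flip: power_mult)
    then have "\<sigma> \<le> z\<^sup>2" by (rule power_mono_iff[THEN iffD1, rotated -1]) (use \<sigma>(1) in auto)
    then have tz: "sqrt t \<le> z" using 2 z by (intro real_le_lsqrt) auto
    \<comment> \<open>The condition \<open>b >= 5\<close> enters as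
      \<open>q - 2 >= 1 / 2\<close>.\<close>
    have "pos_powr (q - 2) t \<le> t powr (1 / 2)"
      using 2 t q_ge by (simp add: pos_powr_def powr_mono')
    also have "\<dots> = sqrt t" using 2 by (simp add: powr_half_sqrt)
    finally have "k * pos_powr (q - 2) t \<le> k * z" using tz k by (intro mult_left_mono) auto
    also have "k * z = 1 / 32" using k by (simp add: z_def)
    finally have "k * pos_powr (q - 2) t * u \<le> 1 / 32 * u" using u by (intro mult_right_mono)
    \<comment> \<open>Either \<open>u\<close> is at most \<open>\<sigma>^2\<close> and the constant
      term suffices, or \<open>u\<close> is larger and
      \<open>u <= u ^ 4 / \<sigma> ^ 6\<close>.\<close>
    also have "\<dots> \<le> 8 * k\<^sup>2 * u ^ 4 / \<sigma> ^ 6 + \<sigma>\<^sup>2 / 32"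
    proof (cases "u \<le> \<sigma>\<^sup>2")
      case True
      then show ?thesis using \<sigma>(1) by (simp add: add_increasing)
    next
      case False
      have "u * \<sigma> ^ 6 = u * (\<sigma>\<^sup>2) ^ 3" by (simp flip: power_mult)
      also have "\<dots> \<le> u * u ^ 3" using False u by (intro mult_left_mono power_mono) auto
      also have "\<dots> = u ^ 4" by (simp add: eval_nat_numeral)
      finally have "u \<le> u ^ 4 / \<sigma> ^ 6" using \<sigma>(1) by (simp add: field_simps)
      moreover have "1 / 32 \<le> 8 * k\<^sup>2" using power_mono[OF k, of 2] by (simp add: power2_eq_square)
      ultimately have "1 / 32 * u \<le> 8 * k\<^sup>2 * (u ^ 4 / \<sigma> ^ 6)" using u by (intro mult_mono) auto
      then show ?thesis by (simp add: add_increasing2)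
    qed
    also have "\<dots> \<le> 8 * k\<^sup>2 * W x t / \<sigma> ^ 6 + \<sigma> ^ 4 / (16 * (\<sigma>\<^sup>2 + t\<^sup>2))"
    proof (intro add_mono divide_right_mono mult_left_mono)
      show "u ^ 4 \<le> W x t" unfolding u_def by (rule W_ge_above[OF x])
      have "t\<^sup>2 \<le> \<sigma>\<^sup>2" using 2 by (intro power_mono) auto
      then have "\<sigma>\<^sup>2 * (16 * (\<sigma>\<^sup>2 + t\<^sup>2)) \<le> \<sigma>\<^sup>2 * (32 * \<sigma>\<^sup>2)" by (intro mult_left_mono) auto
      also have "\<dots> = 32 * \<sigma> ^ 4" by (simp add: eval_nat_numeral)
      finally show "\<sigma>\<^sup>2 / 32 \<le> \<sigma> ^ 4 / (16 * (\<sigma>\<^sup>2 + t\<^sup>2))"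
        using \<sigma>(1) by (simp add: field_simps add_pos_nonneg)
    qed (use \<sigma> in auto)
    finally show ?thesis by (simp add: u_def k_def)
  next
    case 3
    define T where "T = pos_powr (q - 2) t"
    have t0: "t > 0" using 3 \<sigma> by simp
    have rt: "r t = t\<^sup>2 * T"
      using t0 powr_add[of t 2 "q - 2"] by (simp add: r_def T_def pos_powr_def)
    \<comment> \<open>Since \<open>r t = t^2 * T\<close>, the left side is the product
      \<open>Y * X\<close>, where \<open>Y^2\<close> is controlled by \<open>W\<close>. The square
      of \<open>16 * Y - X\<close> gives Young's inequality with the weights 8 and 1 / 32.\<close>
    define Y X where "Y = k * (u * t\<^sup>2 * T) / \<sigma> ^ 3" and "X = \<sigma> ^ 3 / t\<^sup>2"
    have "Y * X = k * T * u" using t0 \<sigma> by (simp add: X_def Y_def field_simps)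
    moreover have "Y * X \<le> 8 * Y\<^sup>2 + X\<^sup>2 / 32"
      using zero_le_power2[of "16 * Y - X"] by (simp add: power2_diff power_mult_distrib)
    moreover have "8 * Y\<^sup>2 \<le> 8 * k\<^sup>2 * W x t / \<sigma> ^ 6"
    proof -
      have "u\<^sup>2 * (r t)\<^sup>2 \<le> W x t" unfolding u_def by (rule W_ge_above[OF x])
      then have "8 * k\<^sup>2 * (u\<^sup>2 * (r t)\<^sup>2) / \<sigma> ^ 6 \<le> 8 * k\<^sup>2 * W x t / \<sigma> ^ 6"
        using \<sigma> by (intro divide_right_mono mult_left_mono) auto
      moreover have "8 * Y\<^sup>2 = 8 * k\<^sup>2 * (u\<^sup>2 * (r t)\<^sup>2) / \<sigma> ^ 6"
        by (simp add: Y_def rt power_mult_distrib power_divide flip: power_mult)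
      ultimately show ?thesis by simp
    qed
    moreover have "X\<^sup>2 / 32 \<le> \<sigma> ^ 4 / (16 * (\<sigma>\<^sup>2 + t\<^sup>2))"
    proof -
      \<comment> \<open>In these variables the claim reduces to
        \<open>S * (S + \<tau>) <= 2 * \<tau>^2\<close>, which holds since
        \<open>S <= \<tau>\<close>.\<close>
      define S \<tau> where "S = \<sigma>\<^sup>2" and "\<tau> = t\<^sup>2"
      have S: "0 < S" "S \<le> \<tau>" using 3 \<sigma> by (auto simp: S_def \<tau>_def power_mono)
      have "S * (S + \<tau>) \<le> \<tau> * (\<tau> + \<tau>)"
        using S by (intro mult_mono) auto
      then have "S / (32 * \<tau>\<^sup>2) \<le> 1 / (16 * (S + \<tau>))"
        using S by (intro frac_le_cross) (auto simp: power2_eq_square algebra_simps)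
      then have "S\<^sup>2 * (S / (32 * \<tau>\<^sup>2)) \<le> S\<^sup>2 * (1 / (16 * (S + \<tau>)))"
        by (intro mult_left_mono) auto
      moreover have "X\<^sup>2 = S ^ 3 / \<tau>\<^sup>2"
        unfolding X_def S_def \<tau>_def by (simp add: power_divide flip: power_mult)
      then have "X\<^sup>2 / 32 = S\<^sup>2 * (S / (32 * \<tau>\<^sup>2))"
        by (simp add: power2_eq_square power3_eq_cube)
      moreover have "\<sigma> ^ 4 = S\<^sup>2" by (simp add: S_def flip: power_mult)
      then have "\<sigma> ^ 4 / (16 * (\<sigma>\<^sup>2 + t\<^sup>2)) = S\<^sup>2 * (1 / (16 * (S + \<tau>)))"
        by (simp add: S_def \<tau>_def)
      ultimately show ?thesis by (simp only:)
    qed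
    ultimately have "k * T * u \<le> 8 * k\<^sup>2 * W x t / \<sigma> ^ 6 + \<sigma> ^ 4 / (16 * (\<sigma>\<^sup>2 + t\<^sup>2))"
      by linarith
    then show ?thesis by (simp only: u_def k_def T_def)
  qed
qed

end

section \<open>Integrability of speeds and arc length of the reference curve\<close>

lemma absolutely_integrable_imp_integrable_on:
  fixes f :: "real \<Rightarrow> real"
  shows "f absolutely_integrable_on S \<Longrightarrow> f integrable_on S"
  by (rule set_lebesgue_integral_eq_integral(1))

lemma absolutely_integrable_sqrt_sum_squares:
  fixes f g :: "real \<Rightarrow> real"
  assumes f: "f absolutely_integrable_on {a..b}" and g: "g absolutely_integrable_on {a..b}"
  shows "(\<lambda>t. sqrt ((f t)\<^sup>2 + (g t)\<^sup>2)) absolutely_integrable_on {a..b}"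
proof (rule measurable_bounded_by_integrable_imp_absolutely_integrable)
  have [measurable]: "f \<in> borel_measurable (lebesgue_on {a..b})" "g \<in> borel_measurable (lebesgue_on {a..b})"
    using f g by (auto intro: absolutely_integrable_imp_borel_measurable)
  show "(\<lambda>t. sqrt ((f t)\<^sup>2 + (g t)\<^sup>2)) \<in> borel_measurable (lebesgue_on {a..b})" by measurable
  show "(\<lambda>t. \<bar>f t\<bar> + \<bar>g t\<bar>) integrable_on {a..b}"
    using f g by (intro integrable_add absolutely_integrable_imp_integrable_on set_integrable_abs)
  show "norm (sqrt ((f t)\<^sup>2 + (g t)\<^sup>2)) \<le> \<bar>f t\<bar> + \<bar>g t\<bar>" for t
    using sqrt_sum_squares_le_sum_abs[of "f t" "g t"] by simp
qed auto

lemma ac_deriv_increment_le: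
  assumes "ac_deriv a b N f f'" "a \<le> u" "u \<le> v" "v \<le> b"
  shows "\<bar>f v - f u\<bar> \<le> integral {u..v} (\<lambda>t. \<bar>f' t\<bar>)"
proof -
  have i: "(f' has_integral (f v - f u)) {u..v}" using assms by (rule ac_deriv_has_integral)
  have "(\<lambda>t. \<bar>f' t\<bar>) absolutely_integrable_on {a..b}"
    using ac_deriv_absolutely_integrable[OF assms(1)] by (rule set_integrable_abs)
  then have "(\<lambda>t. \<bar>f' t\<bar>) absolutely_integrable_on {u..v}"
    by (rule absolutely_integrable_on_subinterval) (use assms in auto)
  then have "norm (integral {u..v} f') \<le> integral {u..v} (\<lambda>t. \<bar>f' t\<bar>)"
    using has_integral_integrable[OF i]
    by (intro integral_norm_bound_integral) (auto intro: absolutely_integrable_imp_integrable_on)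
  with i show ?thesis by (simp add: integral_unique)
qed

context cusp
begin

text \<open>Arc length of the graph of \<open>r\<close>, which is the sub-Riemannian length of both
  curves. The base point -2 leaves room for two-sided derivatives on [-1, 1].\<close>

definition Psi :: "real \<Rightarrow> real" where "Psi t = integral {-2..t} cusp_speed"

lemma Psi_deriv:
  assumes "t \<in> {-1..1}"
  shows "(Psi has_real_derivative cusp_speed t) (at t)"
proof -
  have "((\<lambda>x. integral {-2..x} cusp_speed) has_real_derivative cusp_speed t) (at t within {-2..2})"
    using assms by (intro integral_has_real_derivative continuous_on_cusp_speed) auto
  then have "(Psi has_real_derivative cusp_speed t) (at t within {-2..2})"
    by (simp add: Psi_def [abs_def])
  moreover have "at t within {-2..2} = at t"
    using assms by (intro at_within_interior) (auto simp: interior_atLeastAtMost_real)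
  ultimately show ?thesis by simp
qed

lemma cusp_speed_le_2: "t \<le> rho \<Longrightarrow> cusp_speed t \<le> 2"
proof -
  assume "t \<le> rho"
  then have "(r' t)\<^sup>2 \<le> (1 / 2)\<^sup>2" by (intro power_mono r'_le) auto
  then have "1 + (r' t)\<^sup>2 \<le> 2\<^sup>2" by (simp add: power2_eq_square)
  then show ?thesis unfolding cusp_speed_def by (intro real_le_lsqrt) auto
qed

lemma Psi_diff_le: "Psi (rho / 8) - Psi (- (rho / 8)) \<le> rho / 2"
proof -
  have "norm (Psi (rho / 8) - Psi (- (rho / 8))) \<le> 2 * norm (rho / 8 - (- (rho / 8)))"
  proof (rule field_differentiable_bound[where S = "{- (rho / 8)..rho / 8}" and f' = cusp_speed])
    fix t assume "t \<in> {- (rho / 8)..rho / 8}"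
    then have t: "t \<in> {-1..1}" "t \<le> rho" using rho_bounds(1,2) by auto
    show "(Psi has_real_derivative cusp_speed t) (at t within {- (rho / 8)..rho / 8})"
      using Psi_deriv[OF t(1)] by (rule has_field_derivative_at_within)
    show "norm (cusp_speed t) \<le> 2" using cusp_speed_le_2[OF t(2)] cusp_speed_ge_1[of t] by simp
  qed (use rho_bounds in auto)
  also have "\<dots> = rho / 2" using rho_bounds(1) by simp
  finally show ?thesis by (simp only: real_norm_def)
qed

lemma unit_covector: "(cov_x t)\<^sup>2 + (1 / cusp_speed t)\<^sup>2 = 1"
proof -
  have "(cov_x t)\<^sup>2 + (1 / cusp_speed t)\<^sup>2 = (cusp_speed t)\<^sup>2 / (cusp_speed t)\<^sup>2"
    by (simp add: cov_x_def power_divide cusp_speed_sq add.commute flip: add_divide_distrib)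
  then show ?thesis using cusp_speed_ge_1[of t] by simp
qed

end

text \<open>A strictly shorter horizontal curve between the end points of the branch x1 = r x2, in
  coordinates: \<open>x\<close>, \<open>y\<close>, \<open>z\<close> are the velocities off
  \<open>N\<close>, and the relation for \<open>z\<close> is horizontality. The other branch is
  reduced to this one by reflection.\<close>

locale competitor = cusp +
  fixes T :: real and N :: "real set" and f1 f2 f3 x y z :: "real \<Rightarrow> real"
  assumes T: "0 \<le> T"
    and f1: "ac_deriv 0 T N f1 x" and f2: "ac_deriv 0 T N f2 y" and f3: "ac_deriv 0 T N f3 z"
    and z: "\<And>t. t \<in> {0..T} - N \<Longrightarrow> z t = ((f1 t)\<^sup>2 - (f2 t) ^ b)\<^sup>2 * y t"
    and start: "f1 0 = 0" "f2 0 = - (rho / 8)" "f3 0 = hgt (- (rho / 8))"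
    and finish: "f1 T = r (rho / 8)" "f2 T = rho / 8" "f3 T = 0"
    and short: "integral {0..T} (\<lambda>t. sqrt ((x t)\<^sup>2 + (y t)\<^sup>2)) < Psi (rho / 8) - Psi (- (rho / 8))"
begin

section \<open>Calibration, gain and excess along a competitor\<close>

definition speed :: "real \<Rightarrow> real" where "speed t = sqrt ((x t)\<^sup>2 + (y t)\<^sup>2)"
definition calib :: "real \<Rightarrow> real" where "calib t = cov_x (f2 t) * x t + y t / cusp_speed (f2 t)"
definition gain_density :: "real \<Rightarrow> real" where "gain_density t = cov_x' (f2 t) * (f1 t - r (f2 t)) * y t"
definition bwd :: "real \<Rightarrow> real" where "bwd t = max 0 (- y t)"
definition fwd :: "real \<Rightarrow> real" where "fwd t = max 0 (y t)"
definition gain :: real where "gain = integral {0..T} gain_density"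

lemma neg: "negligible N" using f1 by (simp add: ac_deriv_def)

lemma x_ai: "x absolutely_integrable_on {0..T}" and y_ai: "y absolutely_integrable_on {0..T}"
  using f1 f2 by (auto intro: ac_deriv_absolutely_integrable)

lemma speed_ai: "speed absolutely_integrable_on {0..T}"
  unfolding speed_def [abs_def] using x_ai y_ai by (rule absolutely_integrable_sqrt_sum_squares)

lemma bwd_ai: "bwd absolutely_integrable_on {0..T}" and fwd_ai: "fwd absolutely_integrable_on {0..T}"
proof -
  have "(\<lambda>t. (- 1) * y t) absolutely_integrable_on {0..T}"
    using y_ai by (intro absolutely_integrable_continuous_mult) auto
  then show "bwd absolutely_integrable_on {0..T}" "fwd absolutely_integrable_on {0..T}"
    unfolding bwd_def [abs_def] fwd_def [abs_def]
    using y_ai by (auto intro!: absolutely_integrable_max_1)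
qed

lemma y_split: "y t = fwd t - bwd t" "\<bar>y t\<bar> = fwd t + bwd t"
  by (auto simp: fwd_def bwd_def)

lemma bwd_nonneg [simp]: "0 \<le> bwd t" and fwd_nonneg [simp]: "0 \<le> fwd t"
  by (auto simp: bwd_def fwd_def)

lemma speed_ge: "\<bar>x t\<bar> \<le> speed t" "\<bar>y t\<bar> \<le> speed t"
  unfolding speed_def by (auto intro: real_le_rsqrt)

lemma increment_le_length:
  assumes "ac_deriv 0 T N f f'" "\<And>t. \<bar>f' t\<bar> \<le> speed t" "t \<in> {0..T}"
  shows "\<bar>f t - f 0\<bar> \<le> integral {0..T} speed"
proof -
  have spi: "speed integrable_on {0..T}" "speed integrable_on {0..t}"
    using speed_ai assms(3) by (auto intro!: absolutely_integrable_imp_integrable_on absolutely_integrable_on_subinterval[OF speed_ai])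
  have "(\<lambda>t. \<bar>f' t\<bar>) absolutely_integrable_on {0..T}"
    using ac_deriv_absolutely_integrable[OF assms(1)] by (rule set_integrable_abs)
  then have i: "(\<lambda>t. \<bar>f' t\<bar>) integrable_on {0..t}"
    using assms(3) by (intro absolutely_integrable_imp_integrable_on) (auto elim: absolutely_integrable_on_subinterval)
  have "\<bar>f t - f 0\<bar> \<le> integral {0..t} (\<lambda>t. \<bar>f' t\<bar>)"
    using assms by (intro ac_deriv_increment_le[OF assms(1)]) auto
  also have "\<dots> \<le> integral {0..t} speed"
    using i spi assms(2) by (intro integral_le) auto
  also have "\<dots> \<le> integral {0..T} speed"
    using spi assms(3) speed_ge(1) by (intro integral_subset_le) (auto intro: order_trans[OF abs_ge_zero])
  finally show ?thesis .
qed

lemma len_less: "integral {0..T} speed < Psi (rho / 8) - Psi (- (rho / 8))"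
  using short by (simp add: speed_def [abs_def])

text \<open>The competitor starts within \<open>rho / 8\<close> of the origin of the plane and its
  length is below \<open>rho / 2\<close>.\<close>

lemma box: 
  assumes "t \<in> {0..T}"
  shows "\<bar>f1 t\<bar> \<le> rho" "\<bar>f2 t\<bar> \<le> rho"
  using increment_le_length[OF f1 speed_ge(1) assms] increment_le_length[OF f2 speed_ge(2) assms]
    len_less Psi_diff_le start rho_bounds(1) by linarith+

lemma f2_le: "t \<in> {0..T} \<Longrightarrow> f2 t \<le> rho"
  using box(2) by force

lemma f2_unit: "t \<in> {0..T} \<Longrightarrow> f2 t \<in> {-1..1}"
  using box(2)[of t] rho_bounds(2) by auto

lemma f1_cont: "continuous_on {0..T} f1" and f2_cont: "continuous_on {0..T} f2"
  using f1 f2 by (auto intro: ac_deriv_continuous)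

lemma cont_comp: "(\<And>S. continuous_on S h) \<Longrightarrow> continuous_on {0..T} (\<lambda>t. h (f2 t))"
  using f2_cont continuous_on_compose2[of UNIV h "{0..T}" f2] by auto

lemma calib_ai: "calib absolutely_integrable_on {0..T}"
proof -
  have "(\<lambda>t. cov_x (f2 t) * x t) absolutely_integrable_on {0..T}"
    by (intro absolutely_integrable_continuous_mult cont_comp continuous_on_cov_x x_ai)
  moreover have "(\<lambda>t. (1 / cusp_speed (f2 t)) * y t) absolutely_integrable_on {0..T}"
  proof (intro absolutely_integrable_continuous_mult y_ai continuous_on_divide cont_comp continuous_on_cusp_speed ballI)
    show "cusp_speed (f2 t) \<noteq> 0" for t using cusp_speed_ge_1[of "f2 t"] by auto
  qed auto
  ultimately show ?thesis unfolding calib_def [abs_def] by (auto dest: set_integral_add(1))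
qed

lemma gain_density_ai: "gain_density absolutely_integrable_on {0..T}"
  unfolding gain_density_def [abs_def]
  by (intro absolutely_integrable_continuous_mult y_ai continuous_on_mult continuous_on_diff
    cont_comp continuous_on_cov_x' f1_cont continuous_on_r)

text \<open>The sum of the two densities is the derivative of
  \<open>cov_x (f2 t) * (f1 t - r (f2 t)) + Psi (f2 t)\<close>, whose first term vanishes at both
  ends. The coefficients match because
  \<open>cusp_speed - cov_x * r' = 1 / cusp_speed\<close>.\<close>

lemma int_calib_plus_gain: "integral {0..T} calib + gain = Psi (rho / 8) - Psi (- (rho / 8))"
proof -
  note c = ac_deriv_comp[OF f2 _ _ f2_unit]
  have A: "ac_deriv 0 T N (\<lambda>t. cov_x (f2 t)) (\<lambda>t. cov_x' (f2 t) * y t)"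
    by (rule c) (auto intro: cov_x_deriv continuous_on_cov_x')
  have R: "ac_deriv 0 T N (\<lambda>t. r (f2 t)) (\<lambda>t. r' (f2 t) * y t)"
    by (rule c) (auto intro: r_deriv continuous_on_r')
  have P: "ac_deriv 0 T N (\<lambda>t. Psi (f2 t)) (\<lambda>t. cusp_speed (f2 t) * y t)"
    by (rule c) (auto intro: Psi_deriv continuous_on_cusp_speed)
  have "((\<lambda>t. (cov_x' (f2 t) * y t) * (f1 t - r (f2 t)) + cov_x (f2 t) * (x t - r' (f2 t) * y t) + cusp_speed (f2 t) * y t)
      has_integral (cov_x (f2 T) * (f1 T - r (f2 T)) + Psi (f2 T)) - (cov_x (f2 0) * (f1 0 - r (f2 0)) + Psi (f2 0))) {0..T}"
    by (rule ac_deriv_has_integral[OF ac_deriv_add[OF ac_deriv_mult[OF A ac_deriv_diff[OF f1 R]] P]]) (use T in auto)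
  moreover have "(cov_x' (f2 t) * y t) * (f1 t - r (f2 t)) + cov_x (f2 t) * (x t - r' (f2 t) * y t) + cusp_speed (f2 t) * y t
      = calib t + gain_density t" for t
  proof -
    have "cusp_speed (f2 t) - cov_x (f2 t) * r' (f2 t) = ((cusp_speed (f2 t))\<^sup>2 - (r' (f2 t))\<^sup>2) / cusp_speed (f2 t)"
      using cusp_speed_ge_1[of "f2 t"] by (simp add: cov_x_def field_simps power2_eq_square)
    also have "\<dots> = 1 / cusp_speed (f2 t)" by (simp add: cusp_speed_sq)
    finally have "cusp_speed (f2 t) * y t - cov_x (f2 t) * r' (f2 t) * y t = y t / cusp_speed (f2 t)"
      by (simp flip: left_diff_distrib)
    then show ?thesis by (simp add: calib_def gain_density_def algebra_simps)
  qed
  ultimately have "((\<lambda>t. calib t + gain_density t) has_integral Psi (rho / 8) - Psi (- (rho / 8))) {0..T}"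
    using start finish rho_bounds(1) by simp
  moreover have "((\<lambda>t. calib t + gain_density t) has_integral integral {0..T} calib + gain) {0..T}"
    unfolding gain_def using calib_ai gain_density_ai
    by (intro has_integral_add integrable_integral absolutely_integrable_imp_integrable_on)
  ultimately show ?thesis by (rule has_integral_unique[symmetric])
qed

definition excess :: "real \<Rightarrow> real" where "excess t = speed t - calib t"

lemma excess_ai: "excess absolutely_integrable_on {0..T}"
  unfolding excess_def [abs_def] using speed_ai calib_ai by (rule set_integral_diff(1))

text \<open>This is where strict shortness enters: by the calibration identity, the total excess is
  the gain plus the difference of the two lengths, which is negative.\<close>

lemma int_excess_less: "integral {0..T} excess < gain"
proof -
  have "integral {0..T} excess = integral {0..T} speed - integral {0..T} calib"
    unfolding excess_def [abs_def] using speed_ai calib_ai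
    by (intro integral_diff absolutely_integrable_imp_integrable_on)
  then show ?thesis using int_calib_plus_gain len_less by linarith
qed

text \<open>Cauchy-Schwarz for the unit covector and the vector (x, |y|), which has the same speed,
  bounds the excess below by \<open>2 * \<gamma> * bwd\<close>, and \<open>\<gamma>\<close> is at
  least 1 / 2. For the second bound, \<open>\<alpha> <= 1 / 2\<close> lets half of |x| be absorbed
  into the speed.\<close>

lemma excess_bounds:
  assumes t: "t \<in> {0..T}"
  shows "bwd t \<le> excess t" "\<bar>x t\<bar> \<le> 2 * (excess t + \<bar>y t\<bar>)"
proof -
  define \<alpha> \<gamma> where "\<alpha> = cov_x (f2 t)" and "\<gamma> = 1 / cusp_speed (f2 t)"
  have u: "\<alpha>\<^sup>2 + \<gamma>\<^sup>2 = 1" unfolding \<alpha>_def \<gamma>_def by (rule unit_covector)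
  have s: "cusp_speed (f2 t) \<ge> 1" "cusp_speed (f2 t) \<le> 2" using f2_le[OF t] cusp_speed_le_2 cusp_speed_ge_1 by auto
  have \<gamma>: "1 / 2 \<le> \<gamma>" "\<gamma> \<le> 1" using s by (auto simp: \<gamma>_def field_simps)
  have "\<alpha> \<le> r' (f2 t) / 1" unfolding \<alpha>_def cov_x_def using s by (intro divide_left_mono) auto
  then have \<alpha>: "0 \<le> \<alpha>" "\<alpha> \<le> 1 / 2" using r'_le[OF f2_le[OF t]] s by (auto simp: \<alpha>_def cov_x_def)
  have excess: "excess t = speed t - (\<alpha> * x t + \<gamma> * y t)" by (simp add: excess_def calib_def \<alpha>_def \<gamma>_def)
  have "\<alpha> * x t + \<gamma> * \<bar>y t\<bar> \<le> speed t"
  proof -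
    have "(\<alpha> * x t + \<gamma> * \<bar>y t\<bar>)\<^sup>2 + (\<alpha> * \<bar>y t\<bar> - \<gamma> * x t)\<^sup>2 = (\<alpha>\<^sup>2 + \<gamma>\<^sup>2) * ((x t)\<^sup>2 + \<bar>y t\<bar>\<^sup>2)"
      by (simp add: power2_eq_square algebra_simps)
    then have "(\<alpha> * x t + \<gamma> * \<bar>y t\<bar>)\<^sup>2 + (\<alpha> * \<bar>y t\<bar> - \<gamma> * x t)\<^sup>2 = (x t)\<^sup>2 + (y t)\<^sup>2" using u by simp
    then show ?thesis unfolding speed_def
      using zero_le_power2[of "\<alpha> * \<bar>y t\<bar> - \<gamma> * x t"] by (intro real_le_rsqrt) linarith
  qed
  moreover have "\<gamma> * \<bar>y t\<bar> - \<gamma> * y t = 2 * \<gamma> * bwd t" by (auto simp: bwd_def max_def abs_if)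
  moreover have "bwd t \<le> 2 * \<gamma> * bwd t" using \<gamma> mult_right_mono[of 1 "2 * \<gamma>" "bwd t"] by simp
  ultimately show "bwd t \<le> excess t" unfolding excess by linarith
  have "\<alpha> * x t \<le> 1 / 2 * \<bar>x t\<bar>"
    using \<alpha> mult_mono[of \<alpha> "1/2" "\<bar>x t\<bar>" "\<bar>x t\<bar>"] mult_left_mono[of "x t" "\<bar>x t\<bar>" \<alpha>] by linarith
  moreover have "\<gamma> * y t \<le> 1 * \<bar>y t\<bar>"
    using \<gamma> mult_mono[of \<gamma> 1 "\<bar>y t\<bar>" "\<bar>y t\<bar>"] mult_left_mono[of "y t" "\<bar>y t\<bar>" \<gamma>] by linarith
  moreover have "2 * (excess t + \<bar>y t\<bar>) = 2 * speed t - 2 * (\<alpha> * x t) - 2 * (\<gamma> * y t) + 2 * \<bar>y t\<bar>"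
    unfolding excess by simp
  ultimately show "\<bar>x t\<bar> \<le> 2 * (excess t + \<bar>y t\<bar>)"
    using speed_ge(1)[of t] by linarith
qed

lemma int_bwd_le: "integral {0..T} bwd \<le> integral {0..T} excess"
  using bwd_ai excess_ai excess_bounds(1) by (intro integral_le absolutely_integrable_imp_integrable_on) auto

lemma gain_pos: "0 < gain"
proof -
  have "0 \<le> integral {0..T} bwd" using bwd_ai by (intro integral_nonneg absolutely_integrable_imp_integrable_on) auto
  then show ?thesis using int_bwd_le int_excess_less by linarith
qed

text \<open>Since \<open>calib\<close> is at least minus the speed, the gain is at most twice the
  reference length. The bound supplies the hypothesis on \<open>\<sigma> ^ 3\<close> in
  \<open>key_pointwise\<close>.\<close>

lemma gain_le: "gain \<le> rho"
proof -
  have "calib t \<ge> - speed t" if "t \<in> {0..T}" for t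
  proof -
    define \<alpha> \<gamma> where "\<alpha> = cov_x (f2 t)" and "\<gamma> = 1 / cusp_speed (f2 t)"
    have u: "\<alpha>\<^sup>2 + \<gamma>\<^sup>2 = 1" unfolding \<alpha>_def \<gamma>_def by (rule unit_covector)
    have "calib t = \<alpha> * x t + \<gamma> * y t" by (simp add: calib_def \<alpha>_def \<gamma>_def)
    then have "(calib t)\<^sup>2 + (\<alpha> * y t - \<gamma> * x t)\<^sup>2 = (\<alpha>\<^sup>2 + \<gamma>\<^sup>2) * ((x t)\<^sup>2 + (y t)\<^sup>2)"
      by (simp add: power2_eq_square algebra_simps)
    then have "(calib t)\<^sup>2 \<le> (x t)\<^sup>2 + (y t)\<^sup>2"
      using zero_le_power2[of "\<alpha> * y t - \<gamma> * x t"] by (simp only: u mult_1)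
    then have "\<bar>calib t\<bar> \<le> speed t" unfolding speed_def by (intro real_le_rsqrt) simp
    then show ?thesis by linarith
  qed
  then have "integral {0..T} (\<lambda>t. - speed t) \<le> integral {0..T} calib"
    using speed_ai calib_ai by (intro integral_le integrable_neg absolutely_integrable_imp_integrable_on) auto
  then have "- integral {0..T} speed \<le> integral {0..T} calib" by simp
  then show ?thesis using int_calib_plus_gain len_less Psi_diff_le by linarith
qed

section \<open>The balance of \<open>W\<close> and its consequences\<close>

definition W_along :: "real \<Rightarrow> real" where "W_along t = W (f1 t) (f2 t)"
definition root_along :: "real \<Rightarrow> real" where "root_along t = W_root (f1 t) (f2 t)"

lemma W_along_cont: "continuous_on {0..T} W_along" and root_along_cont: "continuous_on {0..T} root_along"
proof -
  have "continuous_on {0..T} (\<lambda>t. r (- f2 t))"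
    by (rule continuous_on_compose2[of UNIV r]) (auto intro!: continuous_intros f2_cont)
  then show "continuous_on {0..T} W_along" "continuous_on {0..T} root_along"
    unfolding W_along_def [abs_def] W_def [abs_def] root_along_def [abs_def] W_root_def [abs_def]
    by (auto intro!: continuous_intros f1_cont cont_comp[OF continuous_on_r])
qed

lemma W_along_nonneg [simp]: "0 \<le> W_along t" by (simp add: W_along_def)

lemma W_bwd_ai: "(\<lambda>t. W_along t * bwd t) absolutely_integrable_on {0..T}"
  and W_fwd_ai: "(\<lambda>t. W_along t * fwd t) absolutely_integrable_on {0..T}"
  by (intro absolutely_integrable_continuous_mult W_along_cont bwd_ai fwd_ai)+

text \<open>The difference \<open>f3 t - hgt (f2 t)\<close> vanishes at both ends, and by
  \<open>W_eq\<close> its derivative is \<open>W_along t * y t\<close> off the null set.\<close>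

lemma W_balance: "integral {0..T} (\<lambda>t. W_along t * fwd t) = integral {0..T} (\<lambda>t. W_along t * bwd t)"
proof -
  have H: "ac_deriv 0 T N (\<lambda>t. hgt (f2 t)) (\<lambda>t. pos_powr (real (2 * b)) (- f2 t) * y t)"
  proof (rule ac_deriv_comp[OF f2 _ _ f2_unit])
    show "continuous_on {-1..1} (\<lambda>t. pos_powr (real (2 * b)) (- t))"
      using b_ge_5 by (intro continuous_on_compose2[OF continuous_on_pos_powr[of _ UNIV]] continuous_intros) auto
  qed (auto intro: hgt_deriv simp del: of_nat_mult)
  have "((\<lambda>t. z t - pos_powr (real (2 * b)) (- f2 t) * y t) has_integral
      (f3 T - hgt (f2 T)) - (f3 0 - hgt (f2 0))) {0..T}"
    by (rule ac_deriv_has_integral[OF ac_deriv_diff[OF f3 H]]) (use T in auto)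
  then have "((\<lambda>t. z t - pos_powr (real (2 * b)) (- f2 t) * y t) has_integral 0) {0..T}"
    using start finish rho_bounds(1) by (simp add: hgt_def)
  then have zero: "((\<lambda>t. W_along t * fwd t - W_along t * bwd t) has_integral 0) {0..T}"
  proof (rule has_integral_spike[OF neg, rotated])
    fix t assume "t \<in> {0..T} - N"
    then have "z t - pos_powr (real (2 * b)) (- f2 t) * y t = W_along t * y t"
      using z[of t] W_eq[of "f1 t" "f2 t"] by (simp add: W_along_def flip: left_diff_distrib)
    then show "W_along t * fwd t - W_along t * bwd t = z t - pos_powr (real (2 * b)) (- f2 t) * y t"
      by (simp add: y_split(1) algebra_simps)
  qed
  have "((\<lambda>t. W_along t * fwd t - W_along t * bwd t) has_integral
     integral {0..T} (\<lambda>t. W_along t * fwd t) - integral {0..T} (\<lambda>t. W_along t * bwd t)) {0..T}"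
    using W_fwd_ai W_bwd_ai by (intro has_integral_diff integrable_integral absolutely_integrable_imp_integrable_on)
  from has_integral_unique[OF zero this] show ?thesis by simp
qed

lemma int_bwd_less: "integral {0..T} bwd < gain"
  using int_bwd_le int_excess_less by linarith

lemma sub_int:
  fixes f :: "real \<Rightarrow> real"
  assumes "f absolutely_integrable_on {0..T}" "0 \<le> u" "v \<le> T"
  shows "f integrable_on {u..v}"
  using assms by (intro absolutely_integrable_imp_integrable_on absolutely_integrable_on_subinterval[OF assms(1)]) auto

lemma sub_int_le:
  fixes f :: "real \<Rightarrow> real"
  assumes "f absolutely_integrable_on {0..T}" "0 \<le> u" "v \<le> T" "\<And>t. t \<in> {0..T} \<Longrightarrow> 0 \<le> f t"
  shows "integral {u..v} f \<le> integral {0..T} f"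
  using assms by (intro integral_subset_le sub_int) auto

text \<open>Let \<open>m\<close> be the maximum. On the last stretch from level \<open>m / 2\<close>
  up to the maximum, the balance limits forward motion, and backtracking and excess are below the
  gain anyway. The displacement is thus a multiple of the gain, and the Lipschitz bound for
  \<open>W_root\<close> limits the rise \<open>m / 2\<close>.\<close>

lemma root_along_bound:
  assumes "t0 \<in> {0..T}"
  shows "root_along t0 \<le> 318 * rho * gain"
proof -
  obtain tm where tm: "tm \<in> {0..T}" "\<And>t. t \<in> {0..T} \<Longrightarrow> root_along t \<le> root_along tm"
    using continuous_attains_sup[OF _ _ root_along_cont] T by auto
  define m where "m = root_along tm"
  show ?thesis
  proof (cases "m \<le> 0")
    case True
    have "0 \<le> 318 * rho * gain" using rho_bounds(1) gain_pos by simp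
    then show ?thesis using tm(2)[OF assms] True by (simp add: m_def)
  next
    case False
    then have m: "m > 0" by simp
    \<comment> \<open>The competitor starts on the reference curve, so the level
      \<open>m / 2\<close> is passed before the maximum.\<close>
    have "root_along 0 = 0" using start rho_bounds(1) by (simp add: root_along_def W_root_def)
    moreover have "continuous_on {0..tm} root_along" using root_along_cont by (rule continuous_on_subset) (use tm in auto)
    ultimately obtain c where c: "c \<in> {0..tm}" "root_along c = m / 2" "\<And>t. t \<in> {c..tm} \<Longrightarrow> m / 2 \<le> root_along t"
      using last_level_time[of 0 tm root_along "m / 2"] tm m m_def by auto
    have ct: "0 \<le> c" "c \<le> tm" "tm \<le> T" using c tm by auto
    have W1: "m\<^sup>2 / 8 \<le> W_along t" if "t \<in> {c..tm}" for t
    proof -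
      have "(m / 2)\<^sup>2 \<le> (root_along t)\<^sup>2" using c(3)[OF that] m by (intro power_mono) auto
      also have "\<dots> \<le> 2 * W_along t" unfolding root_along_def W_along_def by (rule W_ge)
      finally show ?thesis by (simp add: power_divide)
    qed
    have W2: "W_along t \<le> 2 * m\<^sup>2" if "t \<in> {0..T}" for t
    proof -
      have "W_along t \<le> 2 * (root_along t)\<^sup>2" unfolding root_along_def W_along_def by (rule W_le)
      also have "\<dots> \<le> 2 * m\<^sup>2" using tm(2)[OF that] by (intro mult_left_mono power_mono) (auto simp: m_def root_along_def)
      finally show ?thesis .
    qed
    \<comment> \<open>\<open>W_along\<close> is at least \<open>m^2 / 8\<close> on the stretch and
      at most \<open>2 * m^2\<close> everywhere, so the balance bounds forward motion there by 16
      times the total backtracking.\<close>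
    have "m\<^sup>2 / 8 * integral {c..tm} fwd = integral {c..tm} (\<lambda>t. m\<^sup>2 / 8 * fwd t)" by simp
    also have "\<dots> \<le> integral {c..tm} (\<lambda>t. W_along t * fwd t)"
      using W1 ct sub_int[OF fwd_ai ct(1,3)] sub_int[OF W_fwd_ai ct(1,3)]
      by (intro integral_le integrable_on_mult_right mult_right_mono) auto
    also have "\<dots> \<le> integral {0..T} (\<lambda>t. W_along t * fwd t)"
      using ct W_fwd_ai by (intro sub_int_le) auto
    also have "\<dots> = integral {0..T} (\<lambda>t. W_along t * bwd t)" by (rule W_balance)
    also have "\<dots> \<le> integral {0..T} (\<lambda>t. 2 * m\<^sup>2 * bwd t)"
      using W2 bwd_ai W_bwd_ai
      by (intro integral_le integrable_on_mult_right mult_right_mono absolutely_integrable_imp_integrable_on) auto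
    also have "\<dots> = 2 * m\<^sup>2 * integral {0..T} bwd" by simp
    also have "\<dots> \<le> 2 * m\<^sup>2 * gain" using int_bwd_less by (intro mult_left_mono) auto
    finally have "m\<^sup>2 * integral {c..tm} fwd \<le> m\<^sup>2 * (16 * gain)" by simp
    then have ifwd: "integral {c..tm} fwd \<le> 16 * gain" using m by simp
    have ibwd: "integral {c..tm} bwd \<le> gain"
      using sub_int_le[OF bwd_ai ct(1,3)] int_bwd_less by fastforce
    have iexcess: "integral {c..tm} excess \<le> gain"
      using sub_int_le[OF excess_ai ct(1,3)] int_excess_less excess_bounds(1) by (fastforce intro: order_trans[OF bwd_nonneg])
    note si = sub_int[OF fwd_ai ct(1,3)] sub_int[OF bwd_ai ct(1,3)] sub_int[OF excess_ai ct(1,3)]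
    have ay: "integral {c..tm} (\<lambda>t. \<bar>y t\<bar>) \<le> 17 * gain"
      using ifwd ibwd si by (simp add: y_split(2) integral_add)
    have "integral {c..tm} (\<lambda>t. \<bar>x t\<bar>) \<le> integral {c..tm} (\<lambda>t. 2 * (excess t + (fwd t + bwd t)))"
      using excess_bounds(2) ct si sub_int[OF set_integrable_abs[OF x_ai] ct(1,3)]
      by (intro integral_le integrable_on_mult_right integrable_add) (auto simp: y_split(2))
    also have "\<dots> = 2 * integral {c..tm} excess + 2 * integral {c..tm} fwd + 2 * integral {c..tm} bwd"
      using si by (simp add: integral_add integrable_add)
    \<comment> \<open>The constant is \<open>2 * (1 + 16 + 1)\<close>, from excess, forward and
      backward motion.\<close>
    finally have ax: "integral {c..tm} (\<lambda>t. \<bar>x t\<bar>) \<le> 36 * gain" using ifwd ibwd iexcess by linarith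
    have d1: "\<bar>f1 tm - f1 c\<bar> \<le> 36 * gain"
      using ac_deriv_increment_le[OF f1 ct] ax by linarith
    have d2: "\<bar>f2 tm - f2 c\<bar> \<le> 17 * gain"
      using ac_deriv_increment_le[OF f2 ct] ay by linarith
    have cT: "c \<in> {0..T}" using ct by auto
    have "m / 2 = root_along tm - root_along c" using c(2) by (simp add: m_def)
    also have "\<dots> \<le> \<bar>root_along tm - root_along c\<bar>" by (rule abs_ge_self)
    also have "\<dots> \<le> 3 * rho * (\<bar>f1 tm - f1 c\<bar> + \<bar>f2 tm - f2 c\<bar>)"
      unfolding root_along_def using box[OF cT] box[OF tm(1)] by (intro W_root_lipschitz)
    \<comment> \<open>Here 53 is 36 + 17. Doubling \<open>3 * 53\<close> yields the constant
      318.\<close>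
    also have "\<dots> \<le> 3 * rho * (53 * gain)"
      using d1 d2 rho_bounds(1) by (intro mult_left_mono) auto
    finally show ?thesis using tm(2)[OF assms] by (simp add: m_def)
  qed
qed

section \<open>The closing estimate of the gain\<close>

lemma W_along_bound: "t \<in> {0..T} \<Longrightarrow> W_along t \<le> 2 * (318 * rho)\<^sup>2 * gain\<^sup>2"
proof -
  assume t: "t \<in> {0..T}"
  have "W_along t \<le> 2 * (root_along t)\<^sup>2" unfolding root_along_def W_along_def by (rule W_le)
  also have "\<dots> \<le> 2 * (318 * rho * gain)\<^sup>2"
    using root_along_bound[OF t] by (intro mult_left_mono power_mono) (auto simp: root_along_def)
  finally show ?thesis by (simp add: power_mult_distrib)
qed

text \<open>The \<open>W\<close> term, the exact kernel term, the kernel on backtracking and the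
  direct backtracking term contribute at most 1/8, 1/4, 1/16 and 1/8 of the gain, in total 9/16 of
  it.\<close>

lemma contradiction: False
proof -
  \<comment> \<open>This scale makes \<open>\<sigma> ^ 6\<close> equal to \<open>gain^2\<close>,
    matching the bound on \<open>W_along\<close>, and makes the kernel integral of order
    \<open>gain\<close>.\<close>
  define \<sigma> where "\<sigma> = root 3 gain"
  have \<sigma>: "0 < \<sigma>" "\<sigma> ^ 3 = gain" using gain_pos by (auto simp: \<sigma>_def)
  have \<sigma>1: "\<sigma> ^ 3 \<le> rho" "\<sigma>\<^sup>2 \<le> 1"
  proof -
    show s: "\<sigma> ^ 3 \<le> rho" using \<sigma> gain_le by simp
    have "\<sigma> ^ 3 \<le> 1 ^ 3" using s rho_bounds by simp
    then have "\<sigma> \<le> 1" using \<sigma>(1) by (simp add: power_mono_iff del: power_one)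
    then show "\<sigma>\<^sup>2 \<le> 1" using \<sigma>(1) by (simp add: power_le_one)
  qed
  define A where "A = 8 * (q\<^sup>2)\<^sup>2 / gain\<^sup>2"
  define R where "R t = \<sigma> ^ 4 / (16 * (\<sigma>\<^sup>2 + t\<^sup>2))" for t
  have pos: "\<sigma>\<^sup>2 + t\<^sup>2 > 0" for t using \<sigma>(1) by (simp add: add_pos_nonneg)
  have R_nonneg: "0 \<le> R t" for t using pos[of t] by (simp add: R_def less_imp_le)
  have R_le: "R t \<le> 1 / 16" for t
  proof -
    have "R t \<le> \<sigma> ^ 4 / (16 * \<sigma>\<^sup>2)"
      unfolding R_def using \<sigma>(1) pos[of t] by (intro divide_left_mono) auto
    also have "\<dots> = \<sigma>\<^sup>2 / 16" using \<sigma>(1) by (simp add: eval_nat_numeral)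
    finally show ?thesis using \<sigma>1 by simp
  qed
  have R_cont: "continuous_on S R" for S
    unfolding R_def [abs_def]
  proof (intro continuous_intros ballI)
    show "16 * (\<sigma>\<^sup>2 + t\<^sup>2) \<noteq> 0" for t using pos[of t] by simp
  qed
  have g2: "\<sigma> ^ 6 = gain\<^sup>2" by (simp flip: \<sigma>(2) power_mult)
  have pointwise: "gain_density t \<le> A * (W_along t * fwd t) + R (f2 t) * y t + (R (f2 t) * bwd t + bwd t / 8)" if t: "t \<in> {0..T}" for t
  proof -
    define u where "u = f1 t - r (f2 t)"
    have c1: "0 \<le> cov_x' (f2 t)" "cov_x' (f2 t) \<le> q\<^sup>2 * pos_powr (q - 2) (f2 t)"
      by (rule cov_x'_nonneg, rule cov_x'_le)
    have "cov_x' (f2 t) * u \<le> A * W_along t + R (f2 t)"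
    proof (cases "u \<ge> 0")
      case True
      have "cov_x' (f2 t) * u \<le> q\<^sup>2 * pos_powr (q - 2) (f2 t) * u" using c1(2) True by (rule mult_right_mono)
      also have "\<dots> \<le> 8 * (q\<^sup>2)\<^sup>2 * W (f1 t) (f2 t) / \<sigma> ^ 6 + \<sigma> ^ 4 / (16 * (\<sigma>\<^sup>2 + (f2 t)\<^sup>2))"
        unfolding u_def using True f2_unit[OF t] by (intro key_pointwise \<sigma>(1) \<sigma>1(1)) (auto simp: u_def)
      finally show ?thesis by (simp add: A_def R_def W_along_def g2)
    next
      case False
      then have "cov_x' (f2 t) * u \<le> 0" using c1(1) by (simp add: mult_nonneg_nonpos)
      also have "0 \<le> A * W_along t + R (f2 t)" using R_nonneg by (simp add: A_def)
      finally show ?thesis .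
    qed
    then have 1: "cov_x' (f2 t) * u * fwd t \<le> (A * W_along t + R (f2 t)) * fwd t" by (rule mult_right_mono) simp
    \<comment> \<open>For backward motion a crude bound suffices, because total backtracking is
      already below the gain.\<close>
    have "cov_x' (f2 t) * \<bar>u\<bar> \<le> q\<^sup>2 * (2 * rho)"
    proof (rule mult_mono)
      have "q\<^sup>2 * pos_powr (q - 2) (f2 t) \<le> q\<^sup>2 * 1"
        using q_ge f2_unit[OF t] by (intro mult_left_mono pos_powr_le_1) auto
      then show "cov_x' (f2 t) \<le> q\<^sup>2" using c1 by simp
      show "\<bar>u\<bar> \<le> 2 * rho"
        using box(1)[OF t] r_le[OF f2_le[OF t]] r_nonneg[of "f2 t"] unfolding u_def by linarith
    qed auto
    then have "cov_x' (f2 t) * \<bar>u\<bar> \<le> 1 / 8" using rho_bounds(4) by linarith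
    then have "cov_x' (f2 t) * \<bar>u\<bar> * bwd t \<le> 1 / 8 * bwd t" by (rule mult_right_mono) simp
    moreover have "cov_x' (f2 t) * (- u) * bwd t \<le> cov_x' (f2 t) * \<bar>u\<bar> * bwd t"
      using c1(1) by (intro mult_right_mono mult_left_mono) auto
    ultimately have 2: "cov_x' (f2 t) * (- u) * bwd t \<le> bwd t / 8" by linarith
    have "gain_density t = cov_x' (f2 t) * u * (fwd t - bwd t)"
      using y_split(1)[of t] by (simp only: gain_density_def u_def)
    also have "\<dots> = cov_x' (f2 t) * u * fwd t + cov_x' (f2 t) * (- u) * bwd t"
      by (simp only: right_diff_distrib mult_minus_right mult_minus_left diff_conv_add_uminus distrib_left)
    also have "\<dots> \<le> (A * W_along t + R (f2 t)) * fwd t + bwd t / 8" using 1 2 by (rule add_mono)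
    \<comment> \<open>Writing forward motion as \<open>y t + bwd t\<close> turns the kernel term
      into an exact derivative plus a backtracking term.\<close>
    also have "\<dots> = A * (W_along t * fwd t) + R (f2 t) * (fwd t - bwd t) + (R (f2 t) * bwd t + bwd t / 8)"
      by (simp add: algebra_simps)
    finally show ?thesis by (simp only: y_split(1)[symmetric])
  qed
  have Ry_ai: "(\<lambda>t. R (f2 t) * y t) absolutely_integrable_on {0..T}"
    and R_bwd_ai: "(\<lambda>t. R (f2 t) * bwd t) absolutely_integrable_on {0..T}"
    by (intro absolutely_integrable_continuous_mult cont_comp R_cont y_ai bwd_ai)+
  note ints = W_fwd_ai[THEN absolutely_integrable_imp_integrable_on]
    Ry_ai[THEN absolutely_integrable_imp_integrable_on] R_bwd_ai[THEN absolutely_integrable_imp_integrable_on]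
    bwd_ai[THEN absolutely_integrable_imp_integrable_on] W_bwd_ai[THEN absolutely_integrable_imp_integrable_on]
  have "((\<lambda>t. A * (W_along t * fwd t) + R (f2 t) * y t + (R (f2 t) * bwd t + bwd t / 8)) has_integral
      A * integral {0..T} (\<lambda>t. W_along t * fwd t) + integral {0..T} (\<lambda>t. R (f2 t) * y t)
      + (integral {0..T} (\<lambda>t. R (f2 t) * bwd t) + integral {0..T} bwd / 8)) {0..T}"
    by (intro has_integral_add has_integral_mult_right has_integral_divide integrable_integral ints)
  moreover have "(gain_density has_integral gain) {0..T}"
    unfolding gain_def using gain_density_ai by (intro integrable_integral absolutely_integrable_imp_integrable_on)
  ultimately have main: "gain \<le> A * integral {0..T} (\<lambda>t. W_along t * fwd t) + integral {0..T} (\<lambda>t. R (f2 t) * y t)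
      + (integral {0..T} (\<lambda>t. R (f2 t) * bwd t) + integral {0..T} bwd / 8)"
    using pointwise by (intro has_integral_le[of gain_density gain "{0..T}"]) auto
  \<comment> \<open>The balance trades forward for backward motion; there \<open>W_along\<close> is
    at most a small multiple of \<open>gain^2\<close>, which the denominator of \<open>A\<close>
    cancels.\<close>
  have t1: "A * integral {0..T} (\<lambda>t. W_along t * fwd t) \<le> gain / 8"
  proof -
    have "integral {0..T} (\<lambda>t. W_along t * bwd t) \<le> integral {0..T} (\<lambda>t. (2 * (318 * rho)\<^sup>2 * gain\<^sup>2) * bwd t)"
      using W_along_bound ints by (intro integral_le integrable_on_mult_right mult_right_mono) auto
    also have "\<dots> = 2 * (318 * rho)\<^sup>2 * gain\<^sup>2 * integral {0..T} bwd" by simp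
    also have "\<dots> \<le> 2 * (318 * rho)\<^sup>2 * gain\<^sup>2 * gain"
      using int_bwd_less by (intro mult_left_mono) auto
    finally have "A * integral {0..T} (\<lambda>t. W_along t * bwd t) \<le> A * (2 * (318 * rho)\<^sup>2 * gain\<^sup>2 * gain)"
      by (intro mult_left_mono) (auto simp: A_def)
    also have "\<dots> = (8 * (q\<^sup>2)\<^sup>2 * (2 * (318 * rho)\<^sup>2)) * gain"
      using gain_pos by (simp add: A_def)
    also have "\<dots> \<le> 1 / 8 * gain" using rho_bounds(5) gain_pos by (intro mult_right_mono) auto
    finally show ?thesis by (simp add: W_balance)
  qed
  have t2: "integral {0..T} (\<lambda>t. R (f2 t) * y t) \<le> gain / 4"
  proof -
    define H where "H t = \<sigma> ^ 3 / 16 * arctan (t / \<sigma>)" for t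
    have H: "(H has_real_derivative R t) (at t)" for t
    proof -
      have "((\<lambda>t. t / \<sigma>) has_real_derivative 1 / \<sigma>) (at t)"
        by (rule DERIV_cdivide[OF DERIV_ident])
      from DERIV_cmult[OF DERIV_chain2[OF DERIV_arctan this], of "\<sigma> ^ 3 / 16"]
      have "(H has_real_derivative \<sigma> ^ 3 / 16 * (inverse (1 + (t / \<sigma>)\<^sup>2) * (1 / \<sigma>))) (at t)"
        unfolding H_def [abs_def] .
      moreover have "\<sigma> ^ 3 / 16 * (inverse (1 + (t / \<sigma>)\<^sup>2) * (1 / \<sigma>)) = R t"
      proof -
        have "1 + (t / \<sigma>)\<^sup>2 = (\<sigma>\<^sup>2 + t\<^sup>2) / \<sigma>\<^sup>2"
          using \<sigma>(1) by (simp add: power_divide add_divide_distrib)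
        then show ?thesis using \<sigma>(1) pos[of t]
          by (simp add: R_def eval_nat_numeral field_simps)
      qed
      ultimately show ?thesis by simp
    qed
    have "ac_deriv 0 T N (\<lambda>t. H (f2 t)) (\<lambda>t. R (f2 t) * y t)"
      using H R_cont f2_unit by (intro ac_deriv_comp[OF f2]) auto
    then have "((\<lambda>t. R (f2 t) * y t) has_integral H (f2 T) - H (f2 0)) {0..T}"
      by (rule ac_deriv_has_integral) (use T in auto)
    then have "integral {0..T} (\<lambda>t. R (f2 t) * y t) = H (f2 T) - H (f2 0)" by (rule integral_unique)
    also have "\<dots> = gain / 16 * (arctan (f2 T / \<sigma>) - arctan (f2 0 / \<sigma>))"
      by (simp add: H_def \<sigma>(2) algebra_simps)
    \<comment> \<open>Only the end points matter for the exact term: two values of arctan differ by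
      less than pi, however often the competitor turns.\<close>
    also have "\<dots> \<le> gain / 16 * 4"
      using arctan_bounded[of "f2 T / \<sigma>"] arctan_bounded[of "f2 0 / \<sigma>"] pi_less_4 gain_pos
      by (intro mult_left_mono) auto
    finally show ?thesis by simp
  qed
  have t3: "integral {0..T} (\<lambda>t. R (f2 t) * bwd t) \<le> gain / 16"
  proof -
    have "integral {0..T} (\<lambda>t. R (f2 t) * bwd t) \<le> integral {0..T} (\<lambda>t. 1 / 16 * bwd t)"
      using ints R_le by (intro integral_le integrable_on_mult_right mult_right_mono) auto
    also have "\<dots> = 1 / 16 * integral {0..T} bwd" by (rule integral_mult_right)
    finally show ?thesis using int_bwd_less by linarith
  qed
  show False using main t1 t2 t3 int_bwd_less gain_pos by linarith
qed

end

section \<open>Transfer to horizontal curves and conclusion\<close>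

lemma ac_deriv_shift: "ac_deriv l u {} (\<lambda>t. t - c) (\<lambda>_. 1)"
  unfolding ac_deriv_def by (auto intro!: ac_on_lipschitz[where C = 1] derivative_eq_intros simp: dist_real_def)

lemma ac_on_Pair:
  assumes "ac_on a b f" "ac_on a b g"
  shows "ac_on a b (\<lambda>t. (f t, g t))"
  using assms
  by (rule ac_on_dominated[where C = 1]) (simp add: dist_Pair_Pair sqrt_sum_squares_le_sum)

lemma has_vector_derivative_imp_ac_deriv:
  fixes f :: "real \<Rightarrow> 'a::euclidean_space"
  assumes f: "ac_on a b f" and N: "negligible N"
    and der: "\<And>t. t \<in> {a..b} - N \<Longrightarrow> (f has_vector_derivative f' t) (at t)"
    and h: "bounded_linear (h :: 'a \<Rightarrow> real)"
  shows "ac_deriv a b N (\<lambda>t. h (f t)) (\<lambda>t. h (f' t))"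
  unfolding ac_deriv_def
proof (intro conjI ballI N)
  obtain K where K: "\<And>x. norm (h x) \<le> norm x * K"
    using bounded_linear.bounded[OF h] by blast
  show "ac_on a b (\<lambda>t. h (f t))"
  proof (rule ac_on_dominated[OF f f, where C = "\<bar>K\<bar>"])
    fix s t
    have "dist (h (f s)) (h (f t)) = norm (h (f s - f t))"
      by (simp add: dist_norm bounded_linear.linear[OF h] linear_diff)
    also have "\<dots> \<le> norm (f s - f t) * K" by (rule K)
    also have "\<dots> \<le> norm (f s - f t) * \<bar>K\<bar>"
      by (intro mult_left_mono) auto
    also have "\<dots> \<le> (norm (f s - f t) + norm (f s - f t)) * \<bar>K\<bar>"
      by (intro mult_right_mono) auto
    finally show "dist (h (f s)) (h (f t)) \<le> \<bar>K\<bar> * (dist (f s) (f t) + dist (f s) (f t))"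
      by (simp add: dist_norm mult.commute)
  qed
  show "((\<lambda>t. h (f t)) has_real_derivative h (f' t)) (at t)" if "t \<in> {a..b} - N" for t
    using bounded_linear.has_vector_derivative[OF h der[OF that]]
    by (simp add: has_real_derivative_iff_has_vector_derivative)
qed

lemma Dist_snd:
  assumes "v \<in> Dist b p"
  shows "snd (snd v) = (P b p)\<^sup>2 * fst (snd v)"
  using assms unfolding Dist_def
proof (induction rule: span_induct)
  show "subspace {v. snd (snd v) = (P b p)\<^sup>2 * fst (snd v)}"
    by (auto simp: subspace_def algebra_simps)
qed (auto simp: X1_def X2_def)

lemma Dist_mem: "(u, v, (P b p)\<^sup>2 * v) \<in> Dist b p"
proof -
  have "(u, v, (P b p)\<^sup>2 * v) = u *\<^sub>R X1 p + v *\<^sub>R X2 b p"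
    by (simp add: X1_def X2_def)
  also have "\<dots> \<in> Dist b p"
    unfolding Dist_def by (intro span_add span_scale span_base) auto
  finally show ?thesis .
qed

context cusp
begin

lemma length_ge:
  assumes "0 \<le> T" "ac_deriv 0 T N f1 x" "ac_deriv 0 T N f2 y" "ac_deriv 0 T N f3 z"
    and "\<And>t. t \<in> {0..T} - N \<Longrightarrow> z t = ((f1 t)\<^sup>2 - (f2 t) ^ b)\<^sup>2 * y t"
    and "f1 0 = 0" "f2 0 = - (rho / 8)" "f3 0 = hgt (- (rho / 8))"
    and "f1 T = r (rho / 8)" "f2 T = rho / 8" "f3 T = 0"
  shows "Psi (rho / 8) - Psi (- (rho / 8)) \<le> integral {0..T} (\<lambda>t. sqrt ((x t)\<^sup>2 + (y t)\<^sup>2))"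
proof (rule ccontr)
  assume "\<not> ?thesis"
  then interpret competitor b T N f1 f2 f3 x y z
    using assms by unfold_locales auto
  show False by (rule contradiction)
qed

text \<open>The sign \<open>\<sigma>\<close> selects the branch. The shift \<open>c\<close> is there
  because \<open>d_SR\<close> admits only curves parametrized from time 0.\<close>

definition cusp_curve :: "real \<Rightarrow> real \<Rightarrow> real \<Rightarrow> pt" where
  "cusp_curve \<sigma> c t = (\<sigma> * r (t - c), t - c, hgt (t - c))"

text \<open>\<open>P\<close> and the metric see x1 and its velocity only through squares, so
  multiplying x1 by \<open>\<sigma>\<close> carries a curve between the ends of either branch to one
  for the branch x1 = r x2, of equal length.\<close>

lemma L_SR_ge:
  assumes \<sigma>: "\<sigma>\<^sup>2 = 1" and hor: "horizontal b 0 T \<eta>"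
    and ends: "\<eta> 0 = cusp_curve \<sigma> 0 (- (rho / 8))" "\<eta> T = cusp_curve \<sigma> 0 (rho / 8)"
  shows "Psi (rho / 8) - Psi (- (rho / 8)) \<le> L_SR 0 T \<eta>"
proof -
  define v where "v t = vector_derivative \<eta> (at t)" for t
  have ac: "ac_on 0 T \<eta>" and T: "0 \<le> T" using hor by (auto simp: horizontal_def abs_cont_on_eq)
  have "AE t in lborel. t \<in> {0..T} \<longrightarrow> \<eta> differentiable (at t) \<and> v t \<in> Dist b (\<eta> t)"
    using hor by (simp add: horizontal_def v_def)
  then obtain N where N: "N \<in> null_sets lborel"
    "{t. \<not> (t \<in> {0..T} \<longrightarrow> \<eta> differentiable (at t) \<and> v t \<in> Dist b (\<eta> t))} \<subseteq> N"
    by (auto elim: AE_E2 simp: eventually_ae_filter)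
  have neg: "negligible N"
    using N(1) by (simp add: negligible_iff_null_sets null_sets_completionI)
  have der: "(\<eta> has_vector_derivative v t) (at t)" "v t \<in> Dist b (\<eta> t)" if "t \<in> {0..T} - N" for t
    using N(2) that unfolding v_def by (auto simp flip: vector_derivative_works)
  have bl: "bounded_linear (\<lambda>p :: pt. \<sigma> * fst p)" "bounded_linear (\<lambda>p :: pt. fst (snd p))"
    "bounded_linear (\<lambda>p :: pt. snd (snd p))"
    by (auto intro!: bounded_linear_intros)
  have "Psi (rho / 8) - Psi (- (rho / 8))
      \<le> integral {0..T} (\<lambda>t. sqrt ((\<sigma> * fst (v t))\<^sup>2 + (fst (snd (v t)))\<^sup>2))"
  proof (rule length_ge[OF T])
    show "ac_deriv 0 T N (\<lambda>t. \<sigma> * fst (\<eta> t)) (\<lambda>t. \<sigma> * fst (v t))"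
      "ac_deriv 0 T N (\<lambda>t. fst (snd (\<eta> t))) (\<lambda>t. fst (snd (v t)))"
      "ac_deriv 0 T N (\<lambda>t. snd (snd (\<eta> t))) (\<lambda>t. snd (snd (v t)))"
      using has_vector_derivative_imp_ac_deriv[OF ac neg der(1)] bl by auto
    show "snd (snd (v t)) = ((\<sigma> * fst (\<eta> t))\<^sup>2 - (fst (snd (\<eta> t))) ^ b)\<^sup>2 * fst (snd (v t))"
      if "t \<in> {0..T} - N" for t
      using Dist_snd[OF der(2)[OF that]] \<sigma> by (simp add: P_def power_mult_distrib)
    show "\<sigma> * fst (\<eta> T) = r (rho / 8)"
      using \<sigma> by (simp add: ends cusp_curve_def power2_eq_square flip: mult.assoc)
  qed (use rho_bounds(1) in \<open>simp_all add: ends cusp_curve_def hgt_def\<close>)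
  then show ?thesis
    using \<sigma> by (simp add: L_SR_def gSR_def v_def power_mult_distrib)
qed

lemma cusp_curve_has_derivative:
  "(cusp_curve \<sigma> c has_vector_derivative (\<sigma> * r' (t - c), 1, pos_powr (real (2 * b)) (- (t - c)))) (at t)"
proof -
  have 1: "((\<lambda>t. \<sigma> * r (t - c)) has_real_derivative \<sigma> * (r' (t - c) * 1)) (at t)"
    by (intro DERIV_cmult DERIV_chain2[OF r_deriv]) (auto intro!: derivative_eq_intros)
  have 2: "((\<lambda>t. t - c) has_real_derivative 1) (at t)"
    by (auto intro!: derivative_eq_intros)
  have 3: "((\<lambda>t. hgt (t - c)) has_real_derivative pos_powr (real (2 * b)) (- (t - c)) * 1) (at t)"
    by (intro DERIV_chain2[OF hgt_deriv]) (auto intro!: derivative_eq_intros)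
  show ?thesis
    unfolding cusp_curve_def [abs_def]
    using 1 2 3 by (auto intro!: has_vector_derivative_Pair simp: has_real_derivative_iff_has_vector_derivative)
qed

lemma horizontal_cusp_curve:
  assumes \<sigma>: "\<sigma>\<^sup>2 = 1" and "l \<le> u"
  shows "horizontal b l u (cusp_curve \<sigma> c)"
  unfolding horizontal_def abs_cont_on_eq
proof (intro conjI AE_I2 impI)
  have c: "continuous_on S (\<lambda>t. pos_powr (real (2 * b)) (- t))" for S
    using b_ge_5 by (intro continuous_on_compose2[OF continuous_on_pos_powr[of _ UNIV]] continuous_intros) auto
  have A: "ac_deriv l u {} (\<lambda>t. t - c) (\<lambda>_. 1)" by (rule ac_deriv_shift)
  have R: "ac_deriv l u {} (\<lambda>t. \<sigma> * r (t - c)) (\<lambda>t. \<sigma> * r' (t - c) * 1)"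
    by (rule ac_deriv_comp[OF A, where l = "l - c" and u = "u - c"])
      (auto intro!: DERIV_cmult r_deriv continuous_intros continuous_on_r')
  have H: "ac_deriv l u {} (\<lambda>t. hgt (t - c)) (\<lambda>t. pos_powr (real (2 * b)) (- (t - c)) * 1)"
    by (rule ac_deriv_comp[OF A, where l = "l - c" and u = "u - c"])
      (use c in \<open>auto intro!: hgt_deriv simp del: of_nat_mult\<close>)
  show "ac_on l u (cusp_curve \<sigma> c)"
    unfolding cusp_curve_def [abs_def]
    using A R H by (intro ac_on_Pair) (auto simp: ac_deriv_def)
  fix t
  have d: "vector_derivative (cusp_curve \<sigma> c) (at t) = (\<sigma> * r' (t - c), 1, pos_powr (real (2 * b)) (- (t - c)))"
    by (rule vector_derivative_at) (rule cusp_curve_has_derivative)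
  show "cusp_curve \<sigma> c differentiable at t"
    using cusp_curve_has_derivative by (rule differentiableI_vector)
  \<comment> \<open>Since \<open>W\<close> vanishes on the curve, \<open>W_eq\<close> identifies
    \<open>P^2\<close> there with the derivative of \<open>hgt\<close>, which is
    horizontality.\<close>
  have "W (\<sigma> * r (t - c)) (t - c) = 0"
    using \<sigma> by (cases "t - c \<ge> 0") (auto simp: W_def power_mult_distrib)
  then have "pos_powr (real (2 * b)) (- (t - c)) = (P b (cusp_curve \<sigma> c t))\<^sup>2 * 1"
    using W_eq[of "\<sigma> * r (t - c)" "t - c"] by (simp add: P_def cusp_curve_def)
  then show "vector_derivative (cusp_curve \<sigma> c) (at t) \<in> Dist b (cusp_curve \<sigma> c t)"
    unfolding d by (simp only: Dist_mem)
qed fact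

lemma L_SR_cusp_curve:
  assumes \<sigma>: "\<sigma>\<^sup>2 = 1"
  shows "L_SR (c - rho / 8) (c + rho / 8) (cusp_curve \<sigma> c) = Psi (rho / 8) - Psi (- (rho / 8))"
proof -
  have d: "vector_derivative (cusp_curve \<sigma> c) (at t) = (\<sigma> * r' (t - c), 1, pos_powr (real (2 * b)) (- (t - c)))" for t
    by (rule vector_derivative_at) (rule cusp_curve_has_derivative)
  have "((\<lambda>t. cusp_speed (t - c)) has_integral Psi (c + rho / 8 - c) - Psi (c - rho / 8 - c)) {c - rho / 8..c + rho / 8}"
  proof (rule fundamental_theorem_of_calculus)
    fix t assume t: "t \<in> {c - rho / 8..c + rho / 8}"
    have "((\<lambda>t. Psi (t - c)) has_real_derivative cusp_speed (t - c) * 1) (at t)"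
      using t rho_bounds(1,2) by (intro DERIV_chain2[OF Psi_deriv]) (auto intro!: derivative_eq_intros)
    then show "((\<lambda>t. Psi (t - c)) has_vector_derivative cusp_speed (t - c)) (at t within {c - rho / 8..c + rho / 8})"
      by (simp add: has_real_derivative_iff_has_vector_derivative has_vector_derivative_at_within)
  qed (use rho_bounds(1) in simp)
  moreover have "sqrt (gSR (vector_derivative (cusp_curve \<sigma> c) (at t))) = cusp_speed (t - c)" for t
    unfolding d using \<sigma> by (simp add: gSR_def cusp_speed_def power_mult_distrib add.commute)
  ultimately show ?thesis by (simp add: L_SR_def integral_unique)
qed

lemma cusp_curve_minimizing:
  assumes \<sigma>: "\<sigma>\<^sup>2 = 1"
  shows "horizontal b (- (rho / 8)) (rho / 8) (cusp_curve \<sigma> 0)"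
    and "L_SR (- (rho / 8)) (rho / 8) (cusp_curve \<sigma> 0)
      = d_SR b (cusp_curve \<sigma> 0 (- (rho / 8))) (cusp_curve \<sigma> 0 (rho / 8))"
proof -
  show "horizontal b (- (rho / 8)) (rho / 8) (cusp_curve \<sigma> 0)"
    using rho_bounds(1) by (intro horizontal_cusp_curve \<sigma>) simp
  have "d_SR b (cusp_curve \<sigma> 0 (- (rho / 8))) (cusp_curve \<sigma> 0 (rho / 8)) = Psi (rho / 8) - Psi (- (rho / 8))"
    unfolding d_SR_def
  proof (rule cInf_eq_minimum)
    \<comment> \<open>The copy shifted by \<open>rho / 8\<close> starts at time 0 and attains the
      infimum.\<close>
    have "horizontal b 0 (rho / 8 + rho / 8) (cusp_curve \<sigma> (rho / 8))"
      using rho_bounds(1) by (intro horizontal_cusp_curve \<sigma>) simp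
    then show "Psi (rho / 8) - Psi (- (rho / 8)) \<in> {L_SR 0 T \<eta> |T \<eta>. horizontal b 0 T \<eta> \<and>
        \<eta> 0 = cusp_curve \<sigma> 0 (- (rho / 8)) \<and> \<eta> T = cusp_curve \<sigma> 0 (rho / 8)}"
      using L_SR_cusp_curve[OF \<sigma>, of "rho / 8"]
      by (intro CollectI exI[of _ "rho / 8 + rho / 8"] exI[of _ "cusp_curve \<sigma> (rho / 8)"])
        (auto simp: cusp_curve_def)
  qed (use L_SR_ge[OF \<sigma>] in blast)
  then show "L_SR (- (rho / 8)) (rho / 8) (cusp_curve \<sigma> 0)
      = d_SR b (cusp_curve \<sigma> 0 (- (rho / 8))) (cusp_curve \<sigma> 0 (rho / 8))"
    using L_SR_cusp_curve[OF \<sigma>, of 0] by simp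
qed

lemma hgt_eq: "t < 0 \<Longrightarrow> hgt t = t ^ (2 * b + 1) / real (2 * b + 1)"
  by (simp only: hgt_def) (subst pos_powr_nat, auto simp: divide_simps)

lemma gam_eq: "gam b = cusp_curve 1 0" and gambar_eq: "gambar b = cusp_curve (- 1) 0"
proof -
  \<comment> \<open>At \<open>t = 0\<close> both sides agree, since \<open>0 powr p\<close> is 0 by
    convention.\<close>
  have "r t = t powr (real b / 2)" "hgt t = 0" if "\<not> t < 0" for t
    using that b_ge_5 by (auto simp: r_def pos_powr_def q_def hgt_def)
  then show "gam b = cusp_curve 1 0" "gambar b = cusp_curve (- 1) 0"
    by (auto simp: fun_eq_iff gam_def gambar_def cusp_curve_def hgt_eq)
qed

end

theorem theorem1p1:
  fixes b :: nat
  assumes "odd b" and "b \<ge> 5"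
  shows "\<exists>\<epsilon>>0. \<exists>s>0.
    horizontal b (-s) \<epsilon> (gam b) \<and>
    L_SR (-s) \<epsilon> (gam b) = d_SR b (gam b (-s)) (gam b \<epsilon>) \<and>
    horizontal b (-s) \<epsilon> (gambar b) \<and>
    L_SR (-s) \<epsilon> (gambar b) = d_SR b (gambar b (-s)) (gambar b \<epsilon>)"
proof -
  interpret cusp b by unfold_locales (use assms in auto)
  show ?thesis
    using rho_bounds(1) cusp_curve_minimizing[of 1] cusp_curve_minimizing[of "- 1"]
    unfolding gam_eq gambar_eq by (intro exI[of _ "rho / 8"] conjI) auto
qed

end
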